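(* Let $(U_2^n)_{n\in\mathbb{N}}$ be a sequence of real functions on $(0,+\infty)$ such that $U_2^n\uparrow 0$ pointwise as $n\to\infty$, each $U_2^n$ is not integrable at $0^+$, and $U_2^n\equiv0$ on $[1/n,+\infty)$. Let $\eta\in\mathcal{D}(V^0)$ and $\varepsilon>0$. Then $V^n(\eta)\to V^0(\eta)$ as $n\to\infty$. Moreover, if for each $n$ $c_n^*(\cdot)\in\mathcal{C}(\eta)$ denotes the optimal feedback strategy for the problem $V^n(\eta)$ (so that $J^n(\eta;c_n^*(\cdot))=V^n(\eta)$), then, when $n$ is large enough, $c_n^*(\cdot)$ is $\varepsilon$-optimal for $V^0(\eta)$, i.e. $J^0(\eta;c_n^*(\cdot))>V^0(\eta)-\varepsilon$.
   Context: Setting. Fix $T>0$, $\rho>0$. Put $L^2_{-T}=L^2([-T,0];\mathbb{R})$, $W^{1,2}_{-T}=W^{1,2}([-T,0];\mathbb{R})$, $H_+=(0,+\infty)\times L^2_{-T}$, elements $\eta=(\eta_0,\eta_1(\cdot))$; $\mathbb{R}^+=[0,+\infty)$. Assumptions: $a\in W^{1,2}_{-T}$, $a\ge 0$, $a(-T)=0$, $\int_{-\delta}^0a(\xi)d\xi>0$ for all $\delta>0$; $f_0:[0,\infty)\times\mathbb{R}\to\mathbb{R}$ is jointly concave, nondecreasing in the second variable, Lipschitz continuous with constant $C_{f_0}$, $f_0(0,y)>0$ for all $y>0$, and $f_0(x,0)\ge0$ for all $x\ge0$. (The linear term $rx$ of the state equation is incorporated in $f_0$.) For trajectories that become negative,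 $f_0$ is extended by $f_0(x,y)=f_0(0,y)$ for $x<0$. $U_1\in C([0,\infty))\cap C^2((0,\infty))$ is bounded, $U_1'>0$, $U_1'(0^+)=+\infty$, $U_1''<0$. Each $U_2^n$ satisfies the standing assumptions on state utilities: it is continuous on $(0,\infty)$, increasing (not necessarily strictly), concave, bounded from above, and $\int_0^{\infty}e^{-\rho t}U_2^n(e^{-C_{f_0}t})\,dt>-\infty$. "Not integrable at $0^+$" means $\int_0^\delta U_2^n(x)\,dx=-\infty$ for $\delta>0$. For $\eta\in H_+$ and $c\in L^1_{loc}([0,\infty);\mathbb{R}^+)$, $x(\cdot;\eta,c)$ is the unique solution, absolutely continuous on $[0,\infty)$, of $x(t)=\eta_0+\int_0^t\big[f_0(x(s),\int_{-T}^0a(\xi)x(s+\xi)d\xi)-c(s)\big]ds$, $t\ge0$, with $x=\eta_1$ on $[-T,0)$. Admissible controls: $\mathcal{C}(\eta)=\{c\in L^1_{loc}([0,\infty);\mathbb{R}^+): x(t;\eta,c)>0\ \forall t\ge0\}$. $J^n(\eta;c)=\int_0^\infty e^{-\rho t}[U_1(c(t))+U_2^n(x(t;\eta,c))]dt$ and $J^0(\eta;c)=\int_0^\infty e^{-\rho t}U_1(c(t))dt$; $V^n(\eta)=\sup_{c\in\mathcal{C}(\eta)}J^n(\eta;c)$ and $V^0(\eta)=\sup_{c\in\mathcal{C}(\eta)}J^0(\eta;c)$ ($\sup\emptyset=-\infty$); $\mathcal{D}(V^0)=\{\eta\in H_+:V^0(\eta)>-\infty\}$, and $\mathcal{D}(V^n)$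 similarly. Feedback strategy for $V^n$: $V^n$ is known to be differentiable in the direction $\eta_0$ on $\mathcal{D}(V^n)$ with continuous derivative $V^n_{\eta_0}>0$; with $C^n(\zeta)=\mathrm{argmax}_{c\ge0}(U_1(c)-cV^n_{\eta_0}(\zeta))$, the optimal feedback strategy is $c_n^*(t)=C^n(x_n^*(t),x_n^*(t+\xi)|_{\xi\in[-T,0]})$ where $x_n^*>0$ solves the state equation with $c(t)$ replaced by $C^n(x(t),x(t+\xi)|_{\xi\in[-T,0]})$ and initial datum $\eta$; such a strategy is optimal for $V^n(\eta)$. *)

theory Defs
  imports "HOL-Analysis.Analysis"
begin

text \<open>
  Optimal control of a scalar delay equation with state constraint. The data are the maximal
  delay \<open>T\<close>, the discount rate \<open>\<rho>\<close>, the delay kernel \<open>a\<close>, the drift \<open>f\<^sub>0\<close> with Lipschitz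
  constant \<open>C\<close>, the consumption utility \<open>U\<^sub>1\<close> and a state utility \<open>U\<^sub>2\<close>. Functions on a subset of
  the line are total functions of which only the values on that subset matter; elements of
  Lebesgue spaces are represented by functions.
\<close>

section \<open>Function spaces\<close>

definition square_integrable_on :: "(real \<Rightarrow> real) \<Rightarrow> real set \<Rightarrow> bool" where
  "square_integrable_on h A \<longleftrightarrow>
     set_borel_measurable lebesgue A h \<and> set_integrable lebesgue A (\<lambda>\<xi>. (h \<xi>)\<^sup>2)"

definition test_function :: "real \<Rightarrow> real \<Rightarrow> (real \<Rightarrow> real) \<Rightarrow> bool" where
  "test_function l u \<phi> \<longleftrightarrow>
     (\<forall>k. (deriv ^^ k) \<phi> differentiable_on UNIV) \<and>
     (\<exists>K. compact K \<and> K \<subseteq> {l<..<u} \<and> (\<forall>\<xi>. \<xi> \<notin> K \<longrightarrow> \<phi> \<xi> = 0))"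

text \<open>
  Elements of \<open>W\<^sup>1\<^sup>,\<^sup>2([l,u])\<close> are given by their continuous representative, so that point values
  such as the one at \<open>-T\<close> make sense.
\<close>

definition sobolev_W12 :: "real \<Rightarrow> real \<Rightarrow> (real \<Rightarrow> real) \<Rightarrow> bool" where
  "sobolev_W12 l u h \<longleftrightarrow>
     continuous_on {l..u} h \<and> square_integrable_on h {l..u} \<and>
     (\<exists>g. square_integrable_on g {l..u} \<and>
        (\<forall>\<phi>. test_function l u \<phi> \<longrightarrow>
           (LINT \<xi>:{l..u}|lebesgue. h \<xi> * deriv \<phi> \<xi>) = - (LINT \<xi>:{l..u}|lebesgue. g \<xi> * \<phi> \<xi>)))"

text \<open>
  Lebesgue integral with values in \<open>[-\<infinity>,\<infinity>]\<close>, as positive part minus negative part. It is only used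
  for integrands whose positive part has finite integral, so \<open>\<infinity> - \<infinity>\<close> does not occur.
\<close>

definition ext_integral :: "real set \<Rightarrow> (real \<Rightarrow> real) \<Rightarrow> ereal" where
  "ext_integral A g =
     enn2ereal (\<integral>\<^sup>+ t\<in>A. ennreal (g t) \<partial>lebesgue) - enn2ereal (\<integral>\<^sup>+ t\<in>A. ennreal (- g t) \<partial>lebesgue)"

section \<open>Assumptions on the data\<close>

definition delay_kernel :: "real \<Rightarrow> (real \<Rightarrow> real) \<Rightarrow> bool" where
  "delay_kernel T a \<longleftrightarrow>
     sobolev_W12 (- T) 0 a \<and> (\<forall>\<xi>\<in>{- T..0}. a \<xi> \<ge> 0) \<and> a (- T) = 0 \<and>
     (\<forall>\<delta>. 0 < \<delta> \<and> \<delta> \<le> T \<longrightarrow> (LINT \<xi>:{- \<delta>..0}|lebesgue. a \<xi>) > 0)"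

definition drift :: "(real \<Rightarrow> real \<Rightarrow> real) \<Rightarrow> real \<Rightarrow> bool" where
  "drift f\<^sub>0 C \<longleftrightarrow>
     concave_on ({0..} \<times> UNIV) (\<lambda>(x, y). f\<^sub>0 x y) \<and>
     (\<forall>x\<ge>0. mono (f\<^sub>0 x)) \<and>
     C-lipschitz_on ({0..} \<times> UNIV) (\<lambda>(x, y). f\<^sub>0 x y) \<and>
     (\<forall>y>0. f\<^sub>0 0 y > 0) \<and> (\<forall>x\<ge>0. f\<^sub>0 x 0 \<ge> 0)"

definition consumption_utility :: "(real \<Rightarrow> real) \<Rightarrow> bool" where
  "consumption_utility U\<^sub>1 \<longleftrightarrow>
     continuous_on {0..} U\<^sub>1 \<and>
     U\<^sub>1 differentiable_on {0<..} \<and> deriv U\<^sub>1 differentiable_on {0<..} \<and>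
     continuous_on {0<..} (deriv (deriv U\<^sub>1)) \<and>
     bounded (U\<^sub>1 ` {0..}) \<and>
     (\<forall>c>0. deriv U\<^sub>1 c > 0) \<and> filterlim (deriv U\<^sub>1) at_top (at_right 0) \<and>
     (\<forall>c>0. deriv (deriv U\<^sub>1) c < 0)"

definition state_utility :: "real \<Rightarrow> real \<Rightarrow> (real \<Rightarrow> real) \<Rightarrow> bool" where
  "state_utility \<rho> C U\<^sub>2 \<longleftrightarrow>
     continuous_on {0<..} U\<^sub>2 \<and> mono_on {0<..} U\<^sub>2 \<and> concave_on {0<..} U\<^sub>2 \<and>
     bdd_above (U\<^sub>2 ` {0<..}) \<and>
     ext_integral {0..} (\<lambda>t. exp (- \<rho> * t) * U\<^sub>2 (exp (- C * t))) > -\<infinity>"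

definition not_integrable_at_zero :: "(real \<Rightarrow> real) \<Rightarrow> bool" where
  "not_integrable_at_zero U\<^sub>2 \<longleftrightarrow> (\<forall>\<delta>>0. ext_integral {0<..\<delta>} U\<^sub>2 = -\<infinity>)"

section \<open>State equation and control problem\<close>

type_synonym datum = "real \<times> (real \<Rightarrow> real)"
type_synonym control = "real \<Rightarrow> real"

definition H_plus :: "real \<Rightarrow> datum set" where
  "H_plus T = {(\<eta>\<^sub>0, \<eta>\<^sub>1). \<eta>\<^sub>0 > 0 \<and> square_integrable_on \<eta>\<^sub>1 {- T..0}}"

definition drift_ext :: "(real \<Rightarrow> real \<Rightarrow> real) \<Rightarrow> real \<Rightarrow> real \<Rightarrow> real" where
  "drift_ext f\<^sub>0 x y = (if x < 0 then f\<^sub>0 0 y else f\<^sub>0 x y)"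

definition state_rhs ::
  "real \<Rightarrow> (real \<Rightarrow> real) \<Rightarrow> (real \<Rightarrow> real \<Rightarrow> real) \<Rightarrow> control \<Rightarrow> (real \<Rightarrow> real) \<Rightarrow> real \<Rightarrow> real" where
  "state_rhs T a f\<^sub>0 c x s =
     drift_ext f\<^sub>0 (x s) (LINT \<xi>:{- T..0}|lebesgue. a \<xi> * x (s + \<xi>)) - c s"

text \<open>
  Absolute continuity of \<open>x\<close> on \<open>[0,\<infinity>)\<close> is contained in the local integrability of the right-hand
  side together with the integral equation. The value \<open>0\<close> before \<open>-T\<close>, where the trajectory is not
  defined, only serves to make the solution unique as a total function.
\<close>

definition solves_state_eq ::
  "real \<Rightarrow> (real \<Rightarrow> real) \<Rightarrow> (real \<Rightarrow> real \<Rightarrow> real) \<Rightarrow> datum \<Rightarrow> control \<Rightarrow> (real \<Rightarrow> real) \<Rightarrow> bool" where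
  "solves_state_eq T a f\<^sub>0 \<eta> c x \<longleftrightarrow>
     (\<forall>t < - T. x t = 0) \<and>
     (\<forall>t\<in>{- T..<0}. x t = snd \<eta> t) \<and>
     (\<forall>t\<ge>0. set_integrable lebesgue {0..t} (state_rhs T a f\<^sub>0 c x) \<and>
             x t = fst \<eta> + (LINT s:{0..t}|lebesgue. state_rhs T a f\<^sub>0 c x s))"

definition state ::
  "real \<Rightarrow> (real \<Rightarrow> real) \<Rightarrow> (real \<Rightarrow> real \<Rightarrow> real) \<Rightarrow> datum \<Rightarrow> control \<Rightarrow> real \<Rightarrow> real" where
  "state T a f\<^sub>0 \<eta> c = (THE x. solves_state_eq T a f\<^sub>0 \<eta> c x)"

definition admissible ::
  "real \<Rightarrow> (real \<Rightarrow> real) \<Rightarrow> (real \<Rightarrow> real \<Rightarrow> real) \<Rightarrow> datum \<Rightarrow> control set" where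
  "admissible T a f\<^sub>0 \<eta> =
     {c. (\<forall>t\<ge>0. c t \<ge> 0) \<and> (\<forall>t\<ge>0. set_integrable lebesgue {0..t} c) \<and>
         (\<forall>t\<ge>0. state T a f\<^sub>0 \<eta> c t > 0)}"

definition payoff ::
  "real \<Rightarrow> real \<Rightarrow> (real \<Rightarrow> real) \<Rightarrow> (real \<Rightarrow> real \<Rightarrow> real) \<Rightarrow> (real \<Rightarrow> real) \<Rightarrow> (real \<Rightarrow> real) \<Rightarrow>
   datum \<Rightarrow> control \<Rightarrow> ereal" where
  "payoff T \<rho> a f\<^sub>0 U\<^sub>1 U\<^sub>2 \<eta> c =
     ext_integral {0..} (\<lambda>t. exp (- \<rho> * t) * (U\<^sub>1 (c t) + U\<^sub>2 (state T a f\<^sub>0 \<eta> c t)))"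

definition payoff0 :: "real \<Rightarrow> (real \<Rightarrow> real) \<Rightarrow> control \<Rightarrow> ereal" where
  "payoff0 \<rho> U\<^sub>1 c = ext_integral {0..} (\<lambda>t. exp (- \<rho> * t) * U\<^sub>1 (c t))"

definition value_fun ::
  "real \<Rightarrow> real \<Rightarrow> (real \<Rightarrow> real) \<Rightarrow> (real \<Rightarrow> real \<Rightarrow> real) \<Rightarrow> (real \<Rightarrow> real) \<Rightarrow> (real \<Rightarrow> real) \<Rightarrow>
   datum \<Rightarrow> ereal" where
  "value_fun T \<rho> a f\<^sub>0 U\<^sub>1 U\<^sub>2 \<eta> = (SUP c\<in>admissible T a f\<^sub>0 \<eta>. payoff T \<rho> a f\<^sub>0 U\<^sub>1 U\<^sub>2 \<eta> c)"

definition value_fun0 ::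
  "real \<Rightarrow> real \<Rightarrow> (real \<Rightarrow> real) \<Rightarrow> (real \<Rightarrow> real \<Rightarrow> real) \<Rightarrow> (real \<Rightarrow> real) \<Rightarrow> datum \<Rightarrow> ereal" where
  "value_fun0 T \<rho> a f\<^sub>0 U\<^sub>1 \<eta> = (SUP c\<in>admissible T a f\<^sub>0 \<eta>. payoff0 \<rho> U\<^sub>1 c)"

definition dom_value_fun0 ::
  "real \<Rightarrow> real \<Rightarrow> (real \<Rightarrow> real) \<Rightarrow> (real \<Rightarrow> real \<Rightarrow> real) \<Rightarrow> (real \<Rightarrow> real) \<Rightarrow> datum set" where
  "dom_value_fun0 T \<rho> a f\<^sub>0 U\<^sub>1 = {\<eta> \<in> H_plus T. value_fun0 T \<rho> a f\<^sub>0 U\<^sub>1 \<eta> > -\<infinity>}"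

section \<open>Feedback strategies\<close>

text \<open>
  Derivative of the value function in the direction \<open>\<eta>\<^sub>0\<close>, meaningful on the set where the value
  function is finite.
\<close>

definition value_deriv0 ::
  "real \<Rightarrow> real \<Rightarrow> (real \<Rightarrow> real) \<Rightarrow> (real \<Rightarrow> real \<Rightarrow> real) \<Rightarrow> (real \<Rightarrow> real) \<Rightarrow> (real \<Rightarrow> real) \<Rightarrow>
   datum \<Rightarrow> real" where
  "value_deriv0 T \<rho> a f\<^sub>0 U\<^sub>1 U\<^sub>2 \<zeta> =
     deriv (\<lambda>h. real_of_ereal (value_fun T \<rho> a f\<^sub>0 U\<^sub>1 U\<^sub>2 (h, snd \<zeta>))) (fst \<zeta>)"

definition feedback_map ::
  "real \<Rightarrow> real \<Rightarrow> (real \<Rightarrow> real) \<Rightarrow> (real \<Rightarrow> real \<Rightarrow> real) \<Rightarrow> (real \<Rightarrow> real) \<Rightarrow> (real \<Rightarrow> real) \<Rightarrow>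
   datum \<Rightarrow> real" where
  "feedback_map T \<rho> a f\<^sub>0 U\<^sub>1 U\<^sub>2 \<zeta> =
     arg_max_on (\<lambda>c. U\<^sub>1 c - c * value_deriv0 T \<rho> a f\<^sub>0 U\<^sub>1 U\<^sub>2 \<zeta>) {0..}"

definition feedback_strategy ::
  "real \<Rightarrow> real \<Rightarrow> (real \<Rightarrow> real) \<Rightarrow> (real \<Rightarrow> real \<Rightarrow> real) \<Rightarrow> (real \<Rightarrow> real) \<Rightarrow> (real \<Rightarrow> real) \<Rightarrow>
   datum \<Rightarrow> control \<Rightarrow> bool" where
  "feedback_strategy T \<rho> a f\<^sub>0 U\<^sub>1 U\<^sub>2 \<eta> c \<longleftrightarrow>
     (\<exists>x. (\<forall>t\<ge>0. x t > 0) \<and>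
          solves_state_eq T a f\<^sub>0 \<eta> (\<lambda>t. feedback_map T \<rho> a f\<^sub>0 U\<^sub>1 U\<^sub>2 (x t, \<lambda>\<xi>. x (t + \<xi>))) x \<and>
          (\<forall>t\<ge>0. c t = feedback_map T \<rho> a f\<^sub>0 U\<^sub>1 U\<^sub>2 (x t, \<lambda>\<xi>. x (t + \<xi>))))"

end

theory Submission
  imports Defs
begin

text \<open>
  Since \<open>U\<^sub>2 n \<le> 0\<close>, the bound \<open>V\<^sup>n \<le> V\<^sup>0\<close> is clear. Conversely, a nearly optimal control \<open>c\<close> for \<open>V\<^sup>0\<close> may
  bring the state so close to \<open>0\<close> that its payoff for \<open>V\<^sup>n\<close> is \<open>-\<infinity>\<close>; therefore \<open>c\<close> is replaced by \<open>\<mu> c\<close>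
  with \<open>\<mu> < 1\<close> close to \<open>1\<close>. By concavity and monotonicity of the drift and a comparison argument, the
  state under \<open>\<mu> c\<close> is at least \<open>1 - \<mu>\<close> times the state under the null control, which dominates the
  positive state under \<open>c\<close> and, once its whole memory is nonnegative, decays at most like \<open>exp (- C t)\<close>.
  So the state under \<open>\<mu> c\<close> is at least \<open>k exp (- C t)\<close> with \<open>k > 0\<close>, and the integrability condition on
  the state utilities supplies a dominating function, with which the payoffs of \<open>\<mu> c\<close> for \<open>V\<^sup>n\<close> converge
  to its payoff for \<open>V\<^sup>0\<close>.
\<close>

section \<open>Comparison and integration on the line\<close>

text \<open>
  Look at the maximum of \<open>d s * exp (- L * s)\<close> on \<open>[0,t]\<close> and the last zero of \<open>d\<close> before it. Since
  \<open>step\<close> only concerns intervals where \<open>d > 0\<close>, no positive parts of absolutely continuous functions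
  have to be differentiated.
\<close>

lemma comparison_principle:
  fixes d :: "real \<Rightarrow> real"
  assumes cont: "continuous_on {0..} d" and d0: "d 0 \<le> 0" and q: "q < 1"
    and step: "\<And>t\<^sub>0 t\<^sub>1 E. 0 \<le> t\<^sub>0 \<Longrightarrow> t\<^sub>0 < t\<^sub>1 \<Longrightarrow> d t\<^sub>0 = 0 \<Longrightarrow> (\<And>s. s \<in> {t\<^sub>0<..t\<^sub>1} \<Longrightarrow> d s > 0) \<Longrightarrow>
      E \<ge> 0 \<Longrightarrow> (\<And>s. s \<in> {0..t\<^sub>1} \<Longrightarrow> d s \<le> E * exp (L * s)) \<Longrightarrow> d t\<^sub>1 \<le> q * (E * exp (L * t\<^sub>1))"
    and t: "t \<ge> 0"
  shows "d t \<le> 0"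
proof (rule ccontr)
  assume "\<not> d t \<le> 0"
  then have dt: "d t > 0" by simp
  have "continuous_on {0..t} (\<lambda>s. exp (- L * s) * d s)"
    by (intro continuous_intros continuous_on_subset[OF cont]) auto
  then obtain t\<^sub>1 where t1: "t\<^sub>1 \<in> {0..t}"
    and max: "\<And>s. s \<in> {0..t} \<Longrightarrow> exp (- L * s) * d s \<le> exp (- L * t\<^sub>1) * d t\<^sub>1"
    using continuous_attains_sup[of "{0..t}" "\<lambda>s. exp (- L * s) * d s"] t by auto
  define E where "E = exp (- L * t\<^sub>1) * d t\<^sub>1"
  have "0 < exp (- L * t) * d t" using dt by simp
  also have "\<dots> \<le> E" using max[of t] t by (simp add: E_def)
  finally have E: "E > 0" .
  have dt1: "d t\<^sub>1 = E * exp (L * t\<^sub>1)" by (simp add: E_def exp_minus field_simps)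
  then have "d t\<^sub>1 > 0" using E by simp
  have bound: "d s \<le> E * exp (L * s)" if "s \<in> {0..t\<^sub>1}" for s
  proof -
    have "exp (- L * s) * d s \<le> E" using max[of s] that t1 by (simp add: E_def)
    then show ?thesis by (simp add: exp_minus field_simps)
  qed
  define S where "S = {s \<in> {0..t\<^sub>1}. d s \<le> 0}"
  have "closed S" unfolding S_def
    by (rule continuous_on_closed_Collect_le)
      (auto intro: continuous_on_subset[OF cont])
  moreover have "bounded S" unfolding S_def by (rule bounded_subset[of "{0..t\<^sub>1}"]) auto
  ultimately have "compact S" by (simp add: compact_eq_bounded_closed)
  moreover have "0 \<in> S" using d0 t1 by (auto simp: S_def)
  ultimately obtain t\<^sub>0 where t0: "t\<^sub>0 \<in> S" and last: "\<And>s. s \<in> S \<Longrightarrow> s \<le> t\<^sub>0"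
    using compact_attains_sup[of S] by blast
  \<comment> \<open>If \<open>d t\<^sub>0\<close> were negative, the intermediate value theorem
    would give a zero of \<open>d\<close> after \<open>t\<^sub>0\<close>, hence an element of
    \<open>S\<close> beyond its largest one.\<close>
  have "continuous_on {t\<^sub>0..t\<^sub>1} d"
    using t0 by (intro continuous_on_subset[OF cont]) (auto simp: S_def)
  then obtain s where "s \<in> {t\<^sub>0..t\<^sub>1}" "d s = 0"
    using IVT'[of d t\<^sub>0 0 t\<^sub>1] t0 \<open>d t\<^sub>1 > 0\<close> by (auto simp: S_def)
  then have "d t\<^sub>0 = 0" using last[of s] t0 by (auto simp: S_def)
  have "t\<^sub>0 \<noteq> t\<^sub>1" using t0 \<open>d t\<^sub>1 > 0\<close> by (auto simp: S_def)
  then have "d t\<^sub>1 \<le> q * (E * exp (L * t\<^sub>1))"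
  proof (intro step[of t\<^sub>0])
    show "d s > 0" if "s \<in> {t\<^sub>0<..t\<^sub>1}" for s
      using last[of s] that t0 by (fastforce simp: S_def)
  qed (use t0 \<open>d t\<^sub>0 = 0\<close> bound E in \<open>auto simp: S_def\<close>)
  moreover have "q * (E * exp (L * t\<^sub>1)) < E * exp (L * t\<^sub>1)"
    using q E by simp
  ultimately show False using dt1 by simp
qed

section \<open>Integrals over intervals and continuity on half-lines\<close>

lemma set_integral_increment:
  fixes g :: "real \<Rightarrow> real"
  assumes "set_integrable lebesgue {a..c} g" "a \<le> b" "b \<le> c"
  shows "(LINT s:{a..c}|lebesgue. g s) - (LINT s:{a..b}|lebesgue. g s) = (LINT s:{b..c}|lebesgue. g s)"
proof -
  have i: "set_integrable lebesgue {a..b} g" "set_integrable lebesgue {b..c} g"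
    using assms by (auto intro: set_integrable_subset[OF assms(1)])
  have "integral {a..b} g + integral {b..c} g = integral {a..c} g"
    using assms by (intro Henstock_Kurzweil_Integration.integral_combine)
      (auto intro: set_lebesgue_integral_eq_integral)
  then show ?thesis using set_lebesgue_integral_eq_integral(2)[OF i(1)]
      set_lebesgue_integral_eq_integral(2)[OF i(2)] set_lebesgue_integral_eq_integral(2)[OF assms(1)]
    by simp
qed

text \<open>Near \<open>t\<close> the sets \<open>{a..t+1}\<close> and \<open>{a..}\<close>
  coincide, so continuity on compact intervals suffices.\<close>

lemma continuous_on_atLeastI:
  fixes f :: "real \<Rightarrow> real"
  assumes "\<And>b. b \<ge> a \<Longrightarrow> continuous_on {a..b} f"
  shows "continuous_on {a..} f"
proof -
  have "continuous (at t within {a..}) f" if t: "t \<in> {a..}" for t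
  proof -
    have "continuous (at t within {a..t+1}) f"
      using assms[of "t + 1"] t by (auto simp: continuous_on_eq_continuous_within)
    then show ?thesis
      unfolding continuous_within
    proof (rule Lim_transform_within_set)
      show "\<forall>\<^sub>F u in at t. u \<in> {a..t+1} \<longleftrightarrow> u \<in> {a..}"
        unfolding eventually_at by (rule exI[of _ 1]) (auto simp: dist_real_def)
    qed
  qed
  then show ?thesis by (auto simp: continuous_on_eq_continuous_within)
qed

lemma continuous_on_set_integral:
  fixes g :: "real \<Rightarrow> real"
  assumes "\<And>t. t \<ge> a \<Longrightarrow> set_integrable lebesgue {a..t} g"
  shows "continuous_on {a..} (\<lambda>t. LINT s:{a..t}|lebesgue. g s)"
proof (rule continuous_on_atLeastI)
  fix b assume "b \<ge> a"
  then have "continuous_on {a..b} (\<lambda>u. integral {a..u} g)"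
    by (intro indefinite_integral_continuous_1 set_lebesgue_integral_eq_integral(1) assms)
  then show "continuous_on {a..b} (\<lambda>u. LINT s:{a..u}|lebesgue. g s)"
    by (rule continuous_on_eq) (use set_lebesgue_integral_eq_integral(2)[OF assms] in auto)
qed

text \<open>The nonpositive contribution of the end point \<open>a\<close> is dropped. The factor
  \<open>1 / L\<close> is the gain that makes exponentially weighted estimates contract.\<close>

lemma integral_exp_le:
  fixes L :: real
  assumes "L > 0" "a \<le> b"
  shows "set_integrable lebesgue {a..b} (\<lambda>s. exp (L * s))"
    and "(LINT s:{a..b}|lebesgue. exp (L * s)) \<le> exp (L * b) / L"
proof -
  show i: "set_integrable lebesgue {a..b} (\<lambda>s. exp (L * s))"
    by (intro absolutely_integrable_continuous_real continuous_intros)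
  have "((\<lambda>s. exp (L * s)) has_integral (exp (L * b) / L - exp (L * a) / L)) {a..b}"
    using assms by (intro fundamental_theorem_of_calculus)
      (auto simp flip: has_real_derivative_iff_has_vector_derivative intro!: derivative_eq_intros)
  then show "(LINT s:{a..b}|lebesgue. exp (L * s)) \<le> exp (L * b) / L"
    using set_lebesgue_integral_eq_integral(2)[OF i] assms by (simp add: integral_unique)
qed

text \<open>The interval has finite measure, so \<open>1 + (h \<xi>)\<^sup>2\<close> is an
  integrable majorant.\<close>

lemma square_integrable_imp_integrable:
  assumes "square_integrable_on h {a..b}"
  shows "set_integrable lebesgue {a..b} h"
proof -
  have 1: "set_integrable lebesgue {a..b} (\<lambda>\<xi>. 1 + (h \<xi>)\<^sup>2)"
    using assms by (intro set_integral_add)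
      (auto simp: square_integrable_on_def intro: absolutely_integrable_continuous_real)
  have "\<bar>y\<bar> \<le> 1 + y\<^sup>2" for y :: real
  proof -
    have "0 \<le> (\<bar>y\<bar> - 1)\<^sup>2" by simp
    then show ?thesis by (simp add: power2_diff)
  qed
  then show ?thesis
    using assms by (intro set_integrable_bound[OF 1]) (auto simp: square_integrable_on_def)
qed

section \<open>The state equation\<close>

locale delay_equation =
  fixes T C :: real and a :: "real \<Rightarrow> real" and f\<^sub>0 :: "real \<Rightarrow> real \<Rightarrow> real"
  assumes T: "T > 0" and kernel: "delay_kernel T a" and drift: "drift f\<^sub>0 C"
begin

abbreviation F :: "real \<Rightarrow> real \<Rightarrow> real" where
  "F \<equiv> drift_ext f\<^sub>0"

abbreviation memory :: "(real \<Rightarrow> real) \<Rightarrow> real \<Rightarrow> real" where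
  "memory x s \<equiv> LINT \<xi>:{- T..0}|lebesgue. a \<xi> * x (s + \<xi>)"

definition A :: real where
  "A = (LINT \<xi>:{- T..0}|lebesgue. a \<xi>)"

text \<open>The regularity that trajectories share: continuity from time 0 on, but mere
  integrability on the past, where the datum is only a class of functions. No continuity from the
  left at 0 is asked.\<close>

definition path :: "(real \<Rightarrow> real) \<Rightarrow> bool" where
  "path x \<longleftrightarrow> continuous_on {0..} x \<and> set_integrable lebesgue {- T..0} x"

section \<open>Bounds on the kernel and the drift\<close>

lemma cont_a: "continuous_on {- T..0} a"
  and a_nonneg: "\<xi> \<in> {- T..0} \<Longrightarrow> a \<xi> \<ge> 0"
  using kernel by (auto simp: delay_kernel_def sobolev_W12_def)

lemma integrable_a: "set_integrable lebesgue {- T..0} a"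
  by (rule absolutely_integrable_continuous_real[OF cont_a])

lemma A_nonneg: "A \<ge> 0"
  unfolding A_def set_lebesgue_integral_def
  by (rule Bochner_Integration.integral_nonneg) (use a_nonneg in \<open>auto simp: indicator_def\<close>)

lemma C_nonneg: "C \<ge> 0"
  using drift lipschitz_on_nonneg by (auto simp: drift_def)

text \<open>The extension to negative states is composition with a 1-Lipschitz map, so
  \<open>F\<close> inherits the Lipschitz constant of \<open>f\<^sub>0\<close>.\<close>

lemma F_eq: "F x y = f\<^sub>0 (max x 0) y"
  by (simp add: drift_ext_def max_def)

lemma F_lipschitz: "\<bar>F x y - F x' y'\<bar> \<le> C * \<bar>x - x'\<bar> + C * \<bar>y - y'\<bar>"
proof -
  have "C-lipschitz_on ({0..} \<times> UNIV) (\<lambda>(x, y). f\<^sub>0 x y)"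
    using drift by (simp add: drift_def)
  from lipschitz_onD[OF this, of "(max x 0, y)" "(max x' 0, y')"]
  have "\<bar>F x y - F x' y'\<bar> \<le> C * dist (max x 0, y) (max x' 0, y')"
    by (simp add: F_eq dist_real_def)
  also have "dist (max x 0, y) (max x' 0, y') \<le> \<bar>max x 0 - max x' 0\<bar> + \<bar>y - y'\<bar>"
    unfolding dist_Pair_Pair dist_real_def by (rule order_trans[OF sqrt_sum_squares_le_sum_abs]) simp
  also have "\<bar>max x 0 - max x' 0\<bar> \<le> \<bar>x - x'\<bar>" by (simp add: max_def)
  finally show ?thesis using C_nonneg by (simp add: mult_left_mono distrib_left[symmetric])
qed

lemma F_mono: "y \<le> y' \<Longrightarrow> F x y \<le> F x y'"
  using drift by (auto simp: drift_def F_eq mono_def)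

text \<open>Monotonicity in the second variable allows \<open>y\<close> to be raised to
  \<open>max y y'\<close>. Hence an upper bound on \<open>y - y'\<close> is enough, and comparison
  arguments need no lower bound on differences of memories.\<close>

lemma F_diff_le:
  assumes "y - y' \<le> b" "0 \<le> b"
  shows "F x y - F x' y' \<le> C * \<bar>x - x'\<bar> + C * b"
proof -
  have "F x y \<le> F x (max y y')" by (rule F_mono) simp
  moreover have "F x (max y y') - F x' y' \<le> C * \<bar>x - x'\<bar> + C * \<bar>max y y' - y'\<bar>"
    using F_lipschitz[of x "max y y'" x' y'] by simp
  moreover have "C * \<bar>max y y' - y'\<bar> \<le> C * b"
    using assms C_nonneg by (intro mult_left_mono) (auto simp: max_def)
  ultimately show ?thesis by linarith
qed

text \<open>The value \<open>F 0 0\<close> is nonnegative, moving to \<open>x\<close> costs at most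
  \<open>C * x\<close>, and a nonnegative memory only helps. This is the source of the decay rate
  \<open>exp (- C * t)\<close>.\<close>

lemma drift_ge:
  assumes "x \<ge> 0" "y \<ge> 0"
  shows "F x y \<ge> - C * x"
proof -
  have "F 0 0 \<ge> 0" using drift by (simp add: drift_def F_eq)
  moreover have "F 0 0 - F x 0 \<le> C * x" using F_lipschitz[of 0 0 x 0] assms by simp
  moreover have "F x 0 \<le> F x y" using assms by (intro F_mono)
  ultimately show ?thesis by linarith
qed

section \<open>The memory term along a path\<close>

lemma path_integrable:
  assumes "path x"
  shows "set_integrable lebesgue {- T..N} x"
proof -
  have "set_integrable lebesgue {0..N} x"
    using assms by (intro absolutely_integrable_continuous_real)
      (auto simp: path_def intro: continuous_on_subset)
  then have "set_integrable lebesgue ({- T..0} \<union> {0..N}) x"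
    using assms by (intro set_integrable_Un) (auto simp: path_def)
  then show ?thesis by (rule set_integrable_subset) auto
qed

lemma memory_integrable:
  assumes "path x" "s \<ge> 0"
  shows "set_integrable lebesgue {- T..0} (\<lambda>\<xi>. a \<xi> * x (s + \<xi>))"
proof -
  have "set_integrable lebesgue {s - T..s} x"
    by (rule set_integrable_subset[OF path_integrable[OF assms(1), of s]]) (use assms in auto)
  then have "integrable lebesgue (\<lambda>r. indicator {s - T..s} r *\<^sub>R x r)"
    by (simp add: set_integrable_def)
  from lebesgue_integrable_real_affine[OF this, of 1 s]
  have "set_integrable lebesgue {- T..0} (\<lambda>\<xi>. x (s + \<xi>))"
    by (simp add: set_integrable_def indicator_def cong: if_cong)
  then show ?thesis
    using cont_a by (intro absolutely_integrable_bounded_measurable_product_real)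
      (auto intro: continuous_imp_measurable_on_sets_lebesgue compact_imp_bounded compact_continuous_image)
qed

text \<open>The substitution \<open>r = s + \<xi>\<close> moves the dependence on \<open>s\<close>
  from \<open>x\<close>, which may be rough on the past, to the kernel. The horizon \<open>N\<close>
  keeps the factor containing \<open>x\<close> independent of \<open>s\<close>.\<close>

lemma memory_shift:
  assumes "s \<ge> 0" "s \<le> N"
  shows "memory x s = (LINT r|lebesgue. (indicator {- T..0} (r - s) * a (r - s)) * (indicator {- T..N} r * x r))"
proof -
  have "(LINT r|lebesgue. (indicator {- T..0} (r - s) * a (r - s)) * (indicator {- T..N} r * x r)) =
    (LINT \<xi>|lebesgue. (indicator {- T..0} \<xi> * a \<xi>) * (indicator {- T..N} (s + \<xi>) * x (s + \<xi>)))"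
    by (subst lebesgue_integral_real_affine[of 1 _ s]) auto
  also have "\<dots> = memory x s"
    unfolding set_lebesgue_integral_def
    by (rule Bochner_Integration.integral_cong) (use assms in \<open>auto simp: indicator_def\<close>)
  finally show ?thesis by simp
qed

text \<open>After \<open>memory_shift\<close> only the translated kernel varies; it converges almost
  everywhere and is bounded, so dominated convergence applies.\<close>

lemma memory_continuous:
  assumes "path x"
  shows "continuous_on {0..} (memory x)"
proof (rule continuous_on_sequentiallyI)
  fix u :: "nat \<Rightarrow> real" and s
  assume u: "\<forall>n. u n \<in> {0..}" and s: "s \<in> {0..}" and lim: "u \<longlonglongrightarrow> s"
  \<comment> \<open>A convergent sequence is bounded, so one horizon \<open>N\<close> serves all
    times \<open>u n\<close> and the limit \<open>s\<close>.\<close>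
  from lim have "bounded (range u)" by (simp add: convergent_imp_bounded)
  then obtain N\<^sub>0 where "\<And>n. \<bar>u n\<bar> \<le> N\<^sub>0" by (auto simp: bounded_iff)
  then have N: "u n \<le> max N\<^sub>0 s" for n by (meson abs_le_D1 max.coboundedI1)
  define N where "N = max N\<^sub>0 s"
  define b where "b \<xi> = indicator {- T..0} \<xi> * a \<xi>" for \<xi> :: real
  define g where "g r = indicator {- T..N} r * x r" for r
  have "bounded (a ` {- T..0})"
    by (intro compact_imp_bounded compact_continuous_image cont_a) auto
  then obtain B where "\<forall>\<xi>\<in>{- T..0}. \<bar>a \<xi>\<bar> \<le> B"
    by (auto simp: bounded_iff)
  moreover from this have "0 \<le> B" using T abs_ge_zero[of "a 0"] by (force intro: order_trans)
  ultimately have B: "\<bar>b \<xi>\<bar> \<le> B" for \<xi>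
    by (cases "\<xi> \<in> {- T..0}") (auto simp: b_def)
  have g: "integrable lebesgue g"
    using path_integrable[OF assms, of N] by (simp add: set_integrable_def g_def[abs_def])
  \<comment> \<open>This is a translate of the integrand of \<open>memory x v\<close>, whose
    integrability is known.\<close>
  have meas: "(\<lambda>r. b (r - v) * g r) \<in> borel_measurable lebesgue" if "v \<ge> 0" "v \<le> N" for v
  proof -
    have "integrable lebesgue (\<lambda>\<xi>. indicator {- T..0} \<xi> *\<^sub>R (a \<xi> * x (v + \<xi>)))"
      using memory_integrable[OF assms that(1)] by (simp add: set_integrable_def)
    from lebesgue_integrable_real_affine[OF this, of 1 "- v"]
    have "integrable lebesgue (\<lambda>r. indicator {- T..0} (r - v) * (a (r - v) * x r))" by simp
    also have "(\<lambda>r. indicator {- T..0} (r - v) * (a (r - v) * x r)) = (\<lambda>r. b (r - v) * g r)"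
      using that by (auto simp: fun_eq_iff b_def g_def indicator_def)
    finally show ?thesis by (rule borel_measurable_integrable)
  qed
  have b_cont: "isCont b \<xi>" if "\<xi> \<noteq> - T" "\<xi> \<noteq> 0" for \<xi>
  proof (cases "\<xi> \<in> {- T<..<0}")
    case True
    have "continuous_on {- T<..<0} b"
      by (rule continuous_on_eq[OF continuous_on_subset[OF cont_a]]) (auto simp: b_def)
    then show ?thesis using True by (simp add: continuous_on_eq_continuous_at)
  next
    case False
    have "continuous_on (- {- T..0}) b"
      by (rule continuous_on_eq[OF continuous_on_const[of _ 0]]) (auto simp: b_def)
    moreover have "\<xi> \<in> - {- T..0}" using that False by auto
    ultimately show ?thesis by (simp add: continuous_on_eq_continuous_at open_Compl)
  qed
  \<comment> \<open>Continuity of \<open>b\<close> was shown off the end points \<open>0\<close> and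
    \<open>- T\<close>; for \<open>b (r - s)\<close> these correspond to \<open>r = s\<close> and
    \<open>r = s - T\<close>.\<close>
  have "{s, s - T} \<in> null_sets lebesgue"
    by (simp flip: negligible_iff_null_sets)
  from AE_not_in[OF this]
  have ae: "AE r in lebesgue. (\<lambda>n. b (r - u n) * g r) \<longlonglongrightarrow> b (r - s) * g r"
  proof eventually_elim
    case (elim r)
    then have "isCont b (r - s)" by (intro b_cont) auto
    moreover have "(\<lambda>n. r - u n) \<longlonglongrightarrow> r - s" by (intro tendsto_intros lim)
    ultimately have "(\<lambda>n. b (r - u n)) \<longlonglongrightarrow> b (r - s)" by (rule isCont_tendsto_compose)
    then show ?case by (intro tendsto_intros)
  qed
  have "(\<lambda>n. LINT r|lebesgue. b (r - u n) * g r) \<longlonglongrightarrow> (LINT r|lebesgue. b (r - s) * g r)"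
  proof (rule integral_dominated_convergence[where w = "\<lambda>r. B * \<bar>g r\<bar>"])
    show "AE r in lebesgue. norm (b (r - u n) * g r) \<le> B * \<bar>g r\<bar>" for n
      using B by (intro AE_I2) (auto simp: abs_mult intro: mult_right_mono)
  qed (use meas u N s g ae in \<open>auto simp: N_def\<close>)
  moreover have "memory x (u n) = (LINT r|lebesgue. b (r - u n) * g r)" for n
    unfolding b_def g_def using u N by (intro memory_shift) (auto simp: N_def)
  moreover have "memory x s = (LINT r|lebesgue. b (r - s) * g r)"
    unfolding b_def g_def using s by (intro memory_shift) (auto simp: N_def)
  ultimately show "(\<lambda>n. memory x (u n)) \<longlonglongrightarrow> memory x s" by simp
qed

lemma drift_continuous:
  assumes "path x"
  shows "continuous_on {0..} (\<lambda>s. F (x s) (memory x s))"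
proof (rule continuous_on_sequentiallyI)
  fix u :: "nat \<Rightarrow> real" and s
  assume u: "\<forall>n. u n \<in> {0..}" and s: "s \<in> {0..}" and lim: "u \<longlonglongrightarrow> s"
  have "(\<lambda>n. x (u n)) \<longlonglongrightarrow> x s" "(\<lambda>n. memory x (u n)) \<longlonglongrightarrow> memory x s"
    using u s lim memory_continuous[OF assms] assms
    by (auto simp: path_def continuous_on_sequentially o_def)
  then have "(\<lambda>n. C * \<bar>x (u n) - x s\<bar> + C * \<bar>memory x (u n) - memory x s\<bar>)
      \<longlonglongrightarrow> C * \<bar>x s - x s\<bar> + C * \<bar>memory x s - memory x s\<bar>"
    by (intro tendsto_intros)
  then have bound: "(\<lambda>n. C * \<bar>x (u n) - x s\<bar> + C * \<bar>memory x (u n) - memory x s\<bar>) \<longlonglongrightarrow> 0"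
    by simp
  have "(\<lambda>n. F (x (u n)) (memory x (u n)) - F (x s) (memory x s)) \<longlonglongrightarrow> 0"
    by (rule Lim_null_comparison[OF _ bound]) (simp add: F_lipschitz)
  then show "(\<lambda>n. F (x (u n)) (memory x (u n))) \<longlonglongrightarrow> F (x s) (memory x s)"
    by (simp add: LIM_zero_iff)
qed

section \<open>Exponentially weighted estimates and comparison of trajectories\<close>

text \<open>The pasts agree and the weight increases in time, so at each \<open>s + \<xi>\<close>
  the difference is at most its bound at time \<open>s\<close>; the nonnegative kernel then
  contributes its mass \<open>A\<close>.\<close>

lemma memory_diff_le:
  assumes "path x" "path z" "s \<ge> 0" "E \<ge> 0" "L \<ge> 0"
    and past: "\<And>r. r \<in> {- T..<0} \<Longrightarrow> x r = z r"
    and le: "\<And>r. r \<in> {0..s} \<Longrightarrow> x r - z r \<le> E * exp (L * r)"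
  shows "memory x s - memory z s \<le> A * (E * exp (L * s))"
proof -
  have i: "set_integrable lebesgue {- T..0} (\<lambda>\<xi>. a \<xi> * x (s + \<xi>) - a \<xi> * z (s + \<xi>))"
    using assms by (intro set_integral_diff memory_integrable)
  have "memory x s - memory z s = (LINT \<xi>:{- T..0}|lebesgue. a \<xi> * x (s + \<xi>) - a \<xi> * z (s + \<xi>))"
    using assms by (subst set_integral_diff(2)) (auto intro: memory_integrable)
  also have "\<dots> \<le> (LINT \<xi>:{- T..0}|lebesgue. a \<xi> * (E * exp (L * s)))"
  proof (rule set_integral_mono[OF i])
    show "set_integrable lebesgue {- T..0} (\<lambda>\<xi>. a \<xi> * (E * exp (L * s)))"
      using integrable_a by (intro set_integrable_mult_left) auto
    fix \<xi> assume \<xi>: "\<xi> \<in> {- T..0}"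
    have "x (s + \<xi>) - z (s + \<xi>) \<le> E * exp (L * s)"
    proof (cases "s + \<xi> < 0")
      case True
      then show ?thesis using past[of "s + \<xi>"] \<xi> assms by auto
    next
      case False
      then have "x (s + \<xi>) - z (s + \<xi>) \<le> E * exp (L * (s + \<xi>))" using \<xi> by (intro le) auto
      also have "\<dots> \<le> E * exp (L * s)"
        using \<xi> assms by (intro mult_left_mono) (auto intro!: mult_left_mono)
      finally show ?thesis .
    qed
    then show "a \<xi> * x (s + \<xi>) - a \<xi> * z (s + \<xi>) \<le> a \<xi> * (E * exp (L * s))"
      using a_nonneg[OF \<xi>] by (metis mult_left_mono right_diff_distrib)
  qed
  also have "\<dots> = A * (E * exp (L * s))" by (simp add: A_def)
  finally show ?thesis .
qed

text \<open>A Lipschitz constant of the drift along trajectories: \<open>C\<close> for the present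
  value, \<open>C * A\<close> for the memory.\<close>

definition K :: real where "K = C + C * A"

text \<open>
  With the weight \<open>exp (L * t)\<close> the integral operator of the state equation has Lipschitz constant
  \<open>K / L \<le> 1 / 2\<close>.
\<close>

definition L :: real where "L = 2 * K + 1"

lemma K_nonneg: "K \<ge> 0" and L_pos: "L > 0" and K_L: "K / L < 1" "K / L \<le> 1 / 2"
proof -
  show K: "K \<ge> 0" using C_nonneg A_nonneg by (simp add: K_def)
  then show "L > 0" "K / L < 1" "K / L \<le> 1 / 2" by (auto simp: L_def field_simps)
qed

text \<open>The bound on earlier times may be one-sided because the drift is monotone in the memory;
  at time \<open>s\<close> itself a two-sided bound is required, since the drift need not be
  monotone in the state.\<close>

lemma drift_diff_le:
  assumes "path x" "path z" "s \<ge> 0" "E \<ge> 0"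
    and "\<And>r. r \<in> {- T..<0} \<Longrightarrow> x r = z r"
    and "\<And>r. r \<in> {0..s} \<Longrightarrow> x r - z r \<le> E * exp (L * r)"
    and "\<bar>x s - z s\<bar> \<le> E * exp (L * s)"
  shows "F (x s) (memory x s) - F (z s) (memory z s) \<le> K * (E * exp (L * s))"
proof -
  have "memory x s - memory z s \<le> A * (E * exp (L * s))"
    using L_pos by (intro memory_diff_le assms) auto
  then have "F (x s) (memory x s) - F (z s) (memory z s) \<le> C * \<bar>x s - z s\<bar> + C * (A * (E * exp (L * s)))"
    using A_nonneg assms(4) by (intro F_diff_le) auto
  also have "\<dots> \<le> C * (E * exp (L * s)) + C * (A * (E * exp (L * s)))"
    using C_nonneg by (intro add_right_mono mult_left_mono assms)
  finally show ?thesis by (simp add: K_def distrib_right mult.assoc)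
qed

lemma integral_exp_bound:
  assumes "0 \<le> E" "s \<le> t"
  shows "(LINT r:{s..t}|lebesgue. K * (E * exp (L * r))) \<le> K / L * (E * exp (L * t))"
proof -
  have "(LINT r:{s..t}|lebesgue. K * (E * exp (L * r))) = K * (E * (LINT r:{s..t}|lebesgue. exp (L * r)))"
    by simp
  also have "\<dots> \<le> K * (E * (exp (L * t) / L))"
    using K_nonneg assms integral_exp_le[OF L_pos assms(2)] by (intro mult_left_mono) auto
  finally show ?thesis by (simp add: field_simps)
qed

text \<open>Here \<open>p\<close> and \<open>q\<close> are the rates of change of \<open>z\<close>
  and \<open>w\<close>. Only their difference is compared with that of the drifts, so the result
  covers ordered controls as well as subsolutions obtained from concavity.\<close>

lemma comparison:
  assumes "path z" "path w" and past: "\<And>r. r \<in> {- T..<0} \<Longrightarrow> z r = w r" and "z 0 \<le> w 0"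
    and p: "\<And>t. t \<ge> 0 \<Longrightarrow> set_integrable lebesgue {0..t} p"
    and z: "\<And>t. t \<ge> 0 \<Longrightarrow> z t = z 0 + (LINT s:{0..t}|lebesgue. p s)"
    and q: "\<And>t. t \<ge> 0 \<Longrightarrow> set_integrable lebesgue {0..t} q"
    and w: "\<And>t. t \<ge> 0 \<Longrightarrow> w t = w 0 + (LINT s:{0..t}|lebesgue. q s)"
    and pq: "\<And>s. s \<ge> 0 \<Longrightarrow> p s - q s \<le> F (z s) (memory z s) - F (w s) (memory w s)"
    and "t \<ge> 0"
  shows "z t \<le> w t"
proof -
  have "z t - w t \<le> 0"
  proof (rule comparison_principle[where d = "\<lambda>t. z t - w t" and L = L and q = "K / L"])
    show "continuous_on {0..} (\<lambda>t. z t - w t)"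
      using assms(1,2) by (auto simp: path_def intro: continuous_on_diff)
    fix t\<^sub>0 t\<^sub>1 E :: real
    assume t: "0 \<le> t\<^sub>0" "t\<^sub>0 < t\<^sub>1" and d0: "z t\<^sub>0 - w t\<^sub>0 = 0" and E: "0 \<le> E"
      and pos: "\<And>s. s \<in> {t\<^sub>0<..t\<^sub>1} \<Longrightarrow> 0 < z s - w s"
      and le: "\<And>s. s \<in> {0..t\<^sub>1} \<Longrightarrow> z s - w s \<le> E * exp (L * s)"
    have ip: "set_integrable lebesgue {t\<^sub>0..t\<^sub>1} p" and iq: "set_integrable lebesgue {t\<^sub>0..t\<^sub>1} q"
      using t by (auto intro: set_integrable_subset[OF p[of t\<^sub>1]] set_integrable_subset[OF q[of t\<^sub>1]])
    have "z t\<^sub>1 - w t\<^sub>1 = (LINT s:{t\<^sub>0..t\<^sub>1}|lebesgue. p s) - (LINT s:{t\<^sub>0..t\<^sub>1}|lebesgue. q s)"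
      using set_integral_increment[OF p[of t\<^sub>1], of t\<^sub>0] set_integral_increment[OF q[of t\<^sub>1], of t\<^sub>0]
        z[of t\<^sub>0] z[of t\<^sub>1] w[of t\<^sub>0] w[of t\<^sub>1] t d0 by simp
    also have "\<dots> = (LINT s:{t\<^sub>0..t\<^sub>1}|lebesgue. p s - q s)"
      using ip iq by simp
    also have "\<dots> \<le> (LINT s:{t\<^sub>0..t\<^sub>1}|lebesgue. K * (E * exp (L * s)))"
    proof (rule set_integral_mono)
      show "set_integrable lebesgue {t\<^sub>0..t\<^sub>1} (\<lambda>s. p s - q s)" using ip iq by simp
      show "set_integrable lebesgue {t\<^sub>0..t\<^sub>1} (\<lambda>s. K * (E * exp (L * s)))"
        using integral_exp_le(1)[OF L_pos, of t\<^sub>0 t\<^sub>1] t by simp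
      fix s assume s: "s \<in> {t\<^sub>0..t\<^sub>1}"
      \<comment> \<open>The sign of the difference on this interval turns its upper bound into the
        two-sided bound demanded by \<open>drift_diff_le\<close>.\<close>
      then have "z s - w s \<ge> 0" using pos[of s] d0 by (cases "s = t\<^sub>0") auto
      then have "\<bar>z s - w s\<bar> \<le> E * exp (L * s)" using le[of s] s t by auto
      then have "F (z s) (memory z s) - F (w s) (memory w s) \<le> K * (E * exp (L * s))"
        using s t E le by (intro drift_diff_le assms(1,2) past) auto
      then show "p s - q s \<le> K * (E * exp (L * s))" using pq[of s] s t by auto
    qed
    also have "\<dots> \<le> K / L * (E * exp (L * t\<^sub>1))"
      using t E by (intro integral_exp_bound) auto
    finally show "z t\<^sub>1 - w t\<^sub>1 \<le> K / L * (E * exp (L * t\<^sub>1))" .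
  qed (use \<open>z 0 \<le> w 0\<close> \<open>t \<ge> 0\<close> K_L(1) in simp_all)
  then show ?thesis by simp
qed

section \<open>Existence and uniqueness for the state equation\<close>

context
  fixes \<eta> :: datum
  assumes \<eta>: "set_integrable lebesgue {- T..0} (snd \<eta>)"
begin

text \<open>Past and future may be glued without matching at 0, because \<open>path\<close> asks
  there for continuity from the right only.\<close>

lemma path_if:
  assumes "continuous_on {0..} y"
  shows "path (\<lambda>t. if t \<ge> 0 then y t else if t \<ge> - T then snd \<eta> t else 0)" (is "path ?x")
  unfolding path_def
proof
  show "continuous_on {0..} ?x"
    by (rule continuous_on_eq[OF assms]) auto
  have "set_integrable lebesgue {- T..<0} (snd \<eta>)"
    by (rule set_integrable_subset[OF \<eta>]) auto
  then have 1: "set_integrable lebesgue {- T..<0} ?x"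
    by (subst set_integrable_cong[of lebesgue lebesgue _ "{- T..<0}" _ "snd \<eta>"]) auto
  have 2: "set_integrable lebesgue {0..0} ?x"
    by (rule absolutely_integrable_continuous_real) auto
  have "set_integrable lebesgue ({- T..<0} \<union> {0..0}) ?x"
    using 1 2 by (intro set_integrable_Un) auto
  then show "set_integrable lebesgue {- T..0} ?x" by (rule set_integrable_subset) auto
qed

lemma solution_path:
  assumes "solves_state_eq T a f\<^sub>0 \<eta> c x"
  shows "path x"
proof -
  have "continuous_on {0..} (\<lambda>t. fst \<eta> + (LINT s:{0..t}|lebesgue. state_rhs T a f\<^sub>0 c x s))"
    using assms by (intro continuous_intros continuous_on_set_integral) (auto simp: solves_state_eq_def)
  from path_if[OF this] show ?thesis
  proof (rule back_subst[of path])
    show "(\<lambda>t. if t \<ge> 0 then fst \<eta> + (LINT s:{0..t}|lebesgue. state_rhs T a f\<^sub>0 c x s)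
      else if t \<ge> - T then snd \<eta> t else 0) = x"
      using assms by (auto simp: fun_eq_iff solves_state_eq_def)
  qed
qed

lemma solution_start:
  assumes "solves_state_eq T a f\<^sub>0 \<eta> c x"
  shows "x 0 = fst \<eta>"
proof -
  have "x 0 = fst \<eta> + (LINT s:{0..0}|lebesgue. state_rhs T a f\<^sub>0 c x s)"
    using assms by (simp add: solves_state_eq_def)
  also have "(LINT s:{0..0}|lebesgue. state_rhs T a f\<^sub>0 c x s) = 0"
    using assms by (subst set_lebesgue_integral_eq_integral(2)) (auto simp: solves_state_eq_def)
  finally show ?thesis by simp
qed

text \<open>Consumption enters the right-hand side with a minus sign, so consuming less raises the
  rate and \<open>comparison\<close> applies.\<close>

lemma solution_le:
  assumes "solves_state_eq T a f\<^sub>0 \<eta> c x" "solves_state_eq T a f\<^sub>0 \<eta> c' x'"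
    and "\<And>t. t \<ge> 0 \<Longrightarrow> c' t \<le> c t" "t \<ge> 0"
  shows "x t \<le> x' t"
proof (rule comparison[where z = x and w = x' and p = "state_rhs T a f\<^sub>0 c x" and q = "state_rhs T a f\<^sub>0 c' x'"])
  note start = solution_start[OF assms(1)] solution_start[OF assms(2)]
  show "path x" "path x'" by (rule solution_path[OF assms(1)], rule solution_path[OF assms(2)])
  show "x 0 \<le> x' 0" unfolding start by simp
  show "x t = x 0 + (LINT s:{0..t}|lebesgue. state_rhs T a f\<^sub>0 c x s)"
    "x' t = x' 0 + (LINT s:{0..t}|lebesgue. state_rhs T a f\<^sub>0 c' x' s)" if "t \<ge> 0" for t
    unfolding start using assms(1,2) that by (auto simp: solves_state_eq_def)
  show "state_rhs T a f\<^sub>0 c x s - state_rhs T a f\<^sub>0 c' x' s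
    \<le> F (x s) (memory x s) - F (x' s) (memory x' s)" if "s \<ge> 0" for s
    using assms(3)[OF that] by (simp add: state_rhs_def)
  show "set_integrable lebesgue {0..t} (state_rhs T a f\<^sub>0 c x)"
    "set_integrable lebesgue {0..t} (state_rhs T a f\<^sub>0 c' x')" if "t \<ge> 0" for t
    using assms(1,2) that by (auto simp: solves_state_eq_def)
  show "x r = x' r" if "r \<in> {- T..<0}" for r
    using assms(1,2) that by (auto simp: solves_state_eq_def)
qed (rule assms(4))

text \<open>Two solutions for the same control are compared in both directions; before time 0 their
  values are prescribed, also below \<open>- T\<close>.\<close>

lemma solution_unique:
  assumes "solves_state_eq T a f\<^sub>0 \<eta> c x" "solves_state_eq T a f\<^sub>0 \<eta> c x'"
  shows "x = x'"
proof
  fix t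
  consider "t < - T" | "t \<in> {- T..<0}" | "t \<ge> 0" by force
  then show "x t = x' t"
  proof cases
    case 3
    then show ?thesis using solution_le[OF assms] solution_le[OF assms(2,1)] by force
  qed (use assms in \<open>auto simp: solves_state_eq_def\<close>)
qed

text \<open>Picard iteration: in the norm weighted by \<open>exp (- L * t)\<close> the integral
  operator \<open>\<Phi>\<close> halves distances, so the iterates converge uniformly on every
  bounded interval to a fixed point.\<close>

lemma solution_exists:
  assumes c: "\<And>t. t \<ge> 0 \<Longrightarrow> set_integrable lebesgue {0..t} c"
  shows "\<exists>x. solves_state_eq T a f\<^sub>0 \<eta> c x"
proof -
  \<comment> \<open>\<open>\<Psi>\<close> installs the prescribed past, so all iterates agree before
    time 0 as the estimates on the memory require.\<close>
  define \<Psi> where "\<Psi> y t = (if t \<ge> 0 then y t else if t \<ge> - T then snd \<eta> t else 0)" for y :: "real \<Rightarrow> real" and t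
  define \<Phi> where "\<Phi> x = \<Psi> (\<lambda>t. fst \<eta> + (LINT s:{0..t}|lebesgue. state_rhs T a f\<^sub>0 c x s))" for x
  have \<Psi>: "path (\<Psi> y)" if "continuous_on {0..} y" for y
    using path_if[OF that] by (simp add: \<Psi>_def[abs_def])
  have int: "set_integrable lebesgue {0..t} (state_rhs T a f\<^sub>0 c x)" if "path x" "t \<ge> 0" for x t
  proof -
    have "set_integrable lebesgue {0..t} (\<lambda>s. F (x s) (memory x s))"
      by (intro absolutely_integrable_continuous_real continuous_on_subset[OF drift_continuous] that) auto
    then show ?thesis
      unfolding state_rhs_def[abs_def] using c[OF that(2)] by (rule set_integral_diff)
  qed
  have \<Phi>: "path (\<Phi> x)" if "path x" for x
    unfolding \<Phi>_def using int[OF that] by (intro \<Psi> continuous_intros continuous_on_set_integral)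
  \<comment> \<open>Stated pointwise, with hypotheses on \<open>{0..t}\<close> only, so that it
    serves every horizon without a space of functions.\<close>
  have contraction: "\<bar>\<Phi> x t - \<Phi> z t\<bar> \<le> E / 2 * exp (L * t)"
    if x: "path x" and z: "path z" and past: "\<And>r. r < 0 \<Longrightarrow> x r = z r" and E: "E \<ge> 0" and t: "t \<ge> 0"
      and le: "\<And>r. r \<in> {0..t} \<Longrightarrow> \<bar>x r - z r\<bar> \<le> E * exp (L * r)" for x z t E
  proof -
    have "\<bar>\<Phi> x t - \<Phi> z t\<bar> = \<bar>LINT s:{0..t}|lebesgue. state_rhs T a f\<^sub>0 c x s - state_rhs T a f\<^sub>0 c z s\<bar>"
      using int[OF x t] int[OF z t] t by (simp add: \<Phi>_def \<Psi>_def)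
    also have "\<dots> \<le> (LINT s:{0..t}|lebesgue. \<bar>state_rhs T a f\<^sub>0 c x s - state_rhs T a f\<^sub>0 c z s\<bar>)"
      using set_integral_norm_bound[of lebesgue "{0..t}" "\<lambda>s. state_rhs T a f\<^sub>0 c x s - state_rhs T a f\<^sub>0 c z s"]
        int[OF x t] int[OF z t] by simp
    also have "\<dots> \<le> (LINT s:{0..t}|lebesgue. K * (E * exp (L * s)))"
    proof (rule set_integral_mono)
      show "set_integrable lebesgue {0..t} (\<lambda>s. \<bar>state_rhs T a f\<^sub>0 c x s - state_rhs T a f\<^sub>0 c z s\<bar>)"
        using int[OF x t] int[OF z t] by (intro set_integrable_abs set_integral_diff)
      show "set_integrable lebesgue {0..t} (\<lambda>s. K * (E * exp (L * s)))"
        using integral_exp_le(1)[OF L_pos, of 0 t] t by simp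
      fix s assume s: "s \<in> {0..t}"
      have b: "x r - z r \<le> E * exp (L * r)" "z r - x r \<le> E * exp (L * r)" if "r \<in> {0..s}" for r
        using le[of r] that s by auto
      have "F (x s) (memory x s) - F (z s) (memory z s) \<le> K * (E * exp (L * s))"
        using past s le[OF s] b by (intro drift_diff_le x z E) simp_all
      moreover have "F (z s) (memory z s) - F (x s) (memory x s) \<le> K * (E * exp (L * s))"
        using past[symmetric] s le[OF s] b
        by (intro drift_diff_le x z E) (simp_all add: abs_minus_commute[of "z s"])
      ultimately show "\<bar>state_rhs T a f\<^sub>0 c x s - state_rhs T a f\<^sub>0 c z s\<bar> \<le> K * (E * exp (L * s))"
        by (simp add: state_rhs_def)
    qed
    also have "\<dots> \<le> K / L * (E * exp (L * t))"
      using t E by (intro integral_exp_bound) auto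
    also have "\<dots> \<le> 1 / 2 * (E * exp (L * t))"
      using K_L E by (intro mult_right_mono) auto
    finally show ?thesis by simp
  qed
  define X where "X n = (\<Phi> ^^ n) (\<Psi> (\<lambda>_. fst \<eta>))" for n
  have X_Suc: "X (Suc n) = \<Phi> (X n)" for n by (simp add: X_def)
  have X: "path (X n)" for n
    by (induction n) (auto simp: X_def intro: \<Psi> \<Phi>)
  have X_past: "X n r = (if r \<ge> - T then snd \<eta> r else 0)" if "r < 0" for n r
    using that by (cases n) (auto simp: X_def \<Phi>_def \<Psi>_def)
  have cX: "continuous_on {0..N} (X n)" for n N
    using X[of n] by (auto simp: path_def intro: continuous_on_subset)
  \<comment> \<open>A telescoping series defines the limit at all times at once; no limits on
    different horizons have to be glued.\<close>
  define x where "x = \<Psi> (\<lambda>t. X 0 t + (\<Sum>i. X (Suc i) t - X i t))"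
  have lim: "uniform_limit {0..N} X x sequentially" for N
  proof -
    have "bounded ((\<lambda>t. X 1 t - X 0 t) ` {0..N})"
      by (intro compact_imp_bounded compact_continuous_image continuous_on_diff cX) auto
    then obtain E\<^sub>0 where E0: "\<forall>t\<in>{0..N}. \<bar>X 1 t - X 0 t\<bar> \<le> E\<^sub>0"
      by (auto simp: bounded_iff)
    \<comment> \<open>For \<open>N < 0\<close> the interval is empty and \<open>E\<^sub>0\<close>
      might be negative.\<close>
    define E where "E = max 0 E\<^sub>0"
    have E: "E \<ge> 0" by (simp add: E_def)
    have step: "\<bar>X (Suc n) t - X n t\<bar> \<le> E * (1 / 2) ^ n * exp (L * t)" if "t \<in> {0..N}" for n t
      using that
    proof (induction n arbitrary: t)
      case 0
      then have "\<bar>X 1 t - X 0 t\<bar> \<le> E * 1" using E0 by (force simp: E_def)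
      also have "\<dots> \<le> E * exp (L * t)" using 0 E L_pos by (intro mult_left_mono) auto
      finally show ?case by simp
    next
      case (Suc n)
      have "\<bar>X (Suc (Suc n)) t - X (Suc n) t\<bar> \<le> (E * (1 / 2) ^ n) / 2 * exp (L * t)"
        unfolding X_Suc[of "Suc n"] X_Suc[of n]
      proof (rule contraction)
        show "path (\<Phi> (X n))" "path (X n)" using X[of n] by (auto intro: \<Phi>)
        show "\<Phi> (X n) r = X n r" if "r < 0" for r
          unfolding X_Suc[symmetric] X_past[OF that] ..
        show "\<bar>\<Phi> (X n) r - X n r\<bar> \<le> E * (1 / 2) ^ n * exp (L * r)" if "r \<in> {0..t}" for r
          unfolding X_Suc[symmetric] using that Suc.prems by (intro Suc.IH) auto
      qed (use E Suc.prems in auto)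
      then show ?case by simp
    qed
    have "uniform_limit {0..N} (\<lambda>n t. \<Sum>i<n. X (Suc i) t - X i t) (\<lambda>t. \<Sum>i. X (Suc i) t - X i t) sequentially"
    proof (rule Weierstrass_m_test)
      show "summable (\<lambda>n. E * exp (L * N) * (1 / 2) ^ n)" by (intro summable_mult summable_geometric) simp
      fix n t assume t: "t \<in> {0..N}"
      have "\<bar>X (Suc n) t - X n t\<bar> \<le> E * (1 / 2) ^ n * exp (L * t)" using t by (rule step)
      also have "\<dots> \<le> E * (1 / 2) ^ n * exp (L * N)" using t E L_pos by (intro mult_left_mono) auto
      finally show "norm (X (Suc n) t - X n t) \<le> E * exp (L * N) * (1 / 2) ^ n" by (simp add: ac_simps)
    qed
    then have "uniform_limit {0..N} (\<lambda>n t. X 0 t + (\<Sum>i<n. X (Suc i) t - X i t))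
        (\<lambda>t. X 0 t + (\<Sum>i. X (Suc i) t - X i t)) sequentially"
      by (intro uniform_limit_intros)
    moreover have "X 0 t + (\<Sum>i<n. X (Suc i) t - X i t) = X n t" for n t
      using sum_lessThan_telescope[of "\<lambda>i. X i t" n] by simp
    ultimately have "uniform_limit {0..N} X (\<lambda>t. X 0 t + (\<Sum>i. X (Suc i) t - X i t)) sequentially"
      by simp
    then show ?thesis
      by (rule uniform_limit_cong'[THEN iffD1, rotated -1]) (simp_all add: x_def \<Psi>_def)
  qed
  have "continuous_on {0..} x"
    by (intro continuous_on_atLeastI uniform_limit_theorem[OF _ lim]) (simp_all add: cX)
  then have "path (\<Psi> x)" by (rule \<Psi>)
  moreover have "\<Psi> x = x" by (auto simp: x_def \<Psi>_def fun_eq_iff)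
  ultimately have x: "path x" by simp
  have fixpoint: "\<Phi> x t = x t" if t: "t \<ge> 0" for t
  proof -
    \<comment> \<open>\<open>contraction\<close> carries uniform convergence on
      \<open>{0..t}\<close> through \<open>\<Phi>\<close>; the choice
      \<open>E = e * exp (- L * t)\<close> below makes the resulting error at most
      \<open>e / 2\<close>.\<close>
    have "(\<lambda>n. \<Phi> (X n) t) \<longlonglongrightarrow> \<Phi> x t"
    proof (rule LIMSEQ_I)
      fix e :: real assume e: "e > 0"
      define E where "E = e * exp (- L * t)"
      have E: "E > 0" using e by (simp add: E_def)
      have "\<forall>\<^sub>F n in sequentially. \<forall>r\<in>{0..t}. dist (X n r) (x r) < E"
        using lim E by (rule uniform_limitD)
      then obtain n\<^sub>0 where n0: "\<forall>n\<ge>n\<^sub>0. \<forall>r\<in>{0..t}. \<bar>X n r - x r\<bar> < E"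
        by (auto simp: eventually_sequentially dist_real_def)
      have "norm (\<Phi> (X n) t - \<Phi> x t) < e" if "n \<ge> n\<^sub>0" for n
      proof -
        have "\<bar>\<Phi> (X n) t - \<Phi> x t\<bar> \<le> E / 2 * exp (L * t)"
        proof (rule contraction)
          show "X n r = x r" if "r < 0" for r using X_past that by (simp add: x_def \<Psi>_def)
          fix r assume r: "r \<in> {0..t}"
          have "\<bar>X n r - x r\<bar> \<le> E * 1" using n0 \<open>n \<ge> n\<^sub>0\<close> r by force
          also have "\<dots> \<le> E * exp (L * r)" using r E L_pos by (intro mult_left_mono) auto
          finally show "\<bar>X n r - x r\<bar> \<le> E * exp (L * r)" .
        qed (use X x E t in auto)
        also have "\<dots> < e" using e by (simp add: E_def exp_minus field_simps)
        finally show ?thesis by simp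
      qed
      then show "\<exists>n\<^sub>0. \<forall>n\<ge>n\<^sub>0. norm (\<Phi> (X n) t - \<Phi> x t) < e" by blast
    qed
    moreover have "(\<lambda>n. \<Phi> (X n) t) \<longlonglongrightarrow> x t"
      using tendsto_uniform_limitI[OF lim[of t], of t] t
      unfolding X_Suc[symmetric] by (intro LIMSEQ_Suc) auto
    ultimately show ?thesis by (rule LIMSEQ_unique)
  qed
  have "x t = fst \<eta> + (LINT s:{0..t}|lebesgue. state_rhs T a f\<^sub>0 c x s)" if "t \<ge> 0" for t
    unfolding fixpoint[OF that, symmetric] using that by (simp add: \<Phi>_def \<Psi>_def)
  moreover have "x t = 0" if "t < - T" for t
    using that T by (simp add: x_def \<Psi>_def)
  moreover have "x t = snd \<eta> t" if "t \<in> {- T..<0}" for t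
    using that by (simp add: x_def \<Psi>_def)
  ultimately have "solves_state_eq T a f\<^sub>0 \<eta> c x"
    unfolding solves_state_eq_def using int[OF x] by blast
  then show ?thesis by blast
qed

text \<open>Existence and uniqueness give meaning to the definite description in
  \<open>state\<close>.\<close>

lemma solves_state:
  assumes "\<And>t. t \<ge> 0 \<Longrightarrow> set_integrable lebesgue {0..t} c"
  shows "solves_state_eq T a f\<^sub>0 \<eta> c (state T a f\<^sub>0 \<eta> c)"
  unfolding state_def
proof (rule theI'[where P = "solves_state_eq T a f\<^sub>0 \<eta> c"])
  show "\<exists>!x. solves_state_eq T a f\<^sub>0 \<eta> c x"
    using solution_exists[OF assms] solution_unique[of c] by metis
qed

section \<open>Lower bounds for the state under scaled controls\<close>

abbreviation X :: "control \<Rightarrow> real \<Rightarrow> real" where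
  "X \<equiv> state T a f\<^sub>0 \<eta>"

text \<open>The factor \<open>\<mu>\<close> lets one statement serve the null control,
  \<open>c\<close> itself and the scaled control.\<close>

lemma solves_admissible:
  assumes "c \<in> admissible T a f\<^sub>0 \<eta>"
  shows "solves_state_eq T a f\<^sub>0 \<eta> (\<lambda>t. \<mu> * c t) (X (\<lambda>t. \<mu> * c t))"
  by (rule solves_state) (use assms in \<open>auto simp: admissible_def\<close>)

lemma state_null_pos:
  assumes c: "c \<in> admissible T a f\<^sub>0 \<eta>" and "t \<ge> 0"
  shows "X (\<lambda>_. 0) t > 0"
proof -
  have "X c t \<le> X (\<lambda>_. 0) t"
  proof (rule solution_le[where x = "X c" and x' = "X (\<lambda>_. 0)" and c = c and c' = "\<lambda>_. 0"])
    show "solves_state_eq T a f\<^sub>0 \<eta> c (X c)" "solves_state_eq T a f\<^sub>0 \<eta> (\<lambda>_. 0) (X (\<lambda>_. 0))"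
      using solves_admissible[OF c, of 1] solves_admissible[OF c, of 0] by simp_all
  qed (use assms in \<open>auto simp: admissible_def\<close>)
  then show ?thesis using assms by (force simp: admissible_def)
qed

text \<open>Take for \<open>k\<close> the minimum of the positive state on \<open>{0..T}\<close>.
  After time \<open>T\<close> the memory is nonnegative and \<open>drift_ge\<close> keeps the state
  above the barrier \<open>k * exp (- C * t)\<close>.\<close>

lemma state_null_lower_bound:
  assumes c: "c \<in> admissible T a f\<^sub>0 \<eta>"
  shows "\<exists>k>0. \<forall>t\<ge>0. X (\<lambda>_. 0) t \<ge> k * exp (- C * t)"
proof -
  define x where "x = X (\<lambda>_. 0)"
  have pos: "x t > 0" if "t \<ge> 0" for t
    using state_null_pos[OF c that] by (simp add: x_def)
  have sol: "solves_state_eq T a f\<^sub>0 \<eta> (\<lambda>_. 0) x"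
    using solves_admissible[OF c, of 0] by (simp add: x_def)
  have path: "path x" by (rule solution_path[OF sol])
  then have cont: "continuous_on {0..} x" by (simp add: path_def)
  have "\<exists>t\<in>{0..T}. \<forall>s\<in>{0..T}. x t \<le> x s"
    using T by (intro continuous_attains_inf continuous_on_subset[OF cont]) auto
  then obtain t\<^sub>m where tm: "t\<^sub>m \<in> {0..T}" "\<forall>t\<in>{0..T}. x t\<^sub>m \<le> x t"
    by blast
  define k where "k = x t\<^sub>m"
  have k: "k > 0" using pos tm by (simp add: k_def)
  have le: "k * exp (- C * t) - x t \<le> 0" if "t \<ge> 0" for t
  \<comment> \<open>The step proved here gives \<open>d t\<^sub>1 \<le> 0\<close> outright, hence
    the factor 0 and the trivial weight.\<close>
  proof (rule comparison_principle[where d = "\<lambda>t. k * exp (- C * t) - x t" and q = 0 and L = 0])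
    show "continuous_on {0..} (\<lambda>t. k * exp (- C * t) - x t)"
      by (intro continuous_intros cont)
    have start: "k * exp (- C * s) - x s \<le> 0" if "s \<in> {0..T}" for s
    proof -
      have "k * exp (- C * s) \<le> k * 1" using k C_nonneg that by (intro mult_left_mono) auto
      also have "\<dots> \<le> x s" using tm(2) that by (simp add: k_def)
      finally show ?thesis by simp
    qed
    show "k * exp (- C * 0) - x 0 \<le> 0" using start[of 0] T by simp
    fix t\<^sub>0 t\<^sub>1 E :: real
    assume t: "0 \<le> t\<^sub>0" "t\<^sub>0 < t\<^sub>1" and d0: "k * exp (- C * t\<^sub>0) - x t\<^sub>0 = 0"
      and d: "\<And>s. s \<in> {t\<^sub>0<..t\<^sub>1} \<Longrightarrow> 0 < k * exp (- C * s) - x s"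
    \<comment> \<open>On \<open>{0..T}\<close> the barrier holds by the choice of \<open>k\<close>,
      so it can fail only after \<open>T\<close>, where the memory reads the state at nonnegative
      times.\<close>
    have "T \<le> t\<^sub>0"
    proof (rule ccontr)
      assume "\<not> T \<le> t\<^sub>0"
      then have "min T t\<^sub>1 \<in> {t\<^sub>0<..t\<^sub>1}" "min T t\<^sub>1 \<in> {0..T}" using t T by auto
      from d[OF this(1)] start[OF this(2)] show False by linarith
    qed
    define g where "g = state_rhs T a f\<^sub>0 (\<lambda>_. 0) x"
    have g: "set_integrable lebesgue {0..t\<^sub>1} g" "set_integrable lebesgue {t\<^sub>0..t\<^sub>1} g"
    proof -
      show "set_integrable lebesgue {0..t\<^sub>1} g" using sol t by (simp add: solves_state_eq_def g_def)
      then show "set_integrable lebesgue {t\<^sub>0..t\<^sub>1} g" by (rule set_integrable_subset) (use t in auto)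
    qed
    have i: "set_integrable lebesgue {t\<^sub>0..t\<^sub>1} (\<lambda>s. - C * (k * exp (- C * s)))"
      by (intro absolutely_integrable_continuous_real continuous_intros)
    have "((\<lambda>s. - C * (k * exp (- C * s))) has_integral (k * exp (- C * t\<^sub>1) - k * exp (- C * t\<^sub>0))) {t\<^sub>0..t\<^sub>1}"
      using t by (intro fundamental_theorem_of_calculus)
        (auto simp flip: has_real_derivative_iff_has_vector_derivative intro!: derivative_eq_intros)
    then have "k * exp (- C * t\<^sub>1) - k * exp (- C * t\<^sub>0) = (LINT s:{t\<^sub>0..t\<^sub>1}|lebesgue. - C * (k * exp (- C * s)))"
      unfolding set_lebesgue_integral_eq_integral(2)[OF i] by (rule integral_unique[symmetric])
    also have "\<dots> \<le> (LINT s:{t\<^sub>0..t\<^sub>1}|lebesgue. g s)"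
    proof (rule set_integral_mono[OF i g(2)])
      fix s assume s: "s \<in> {t\<^sub>0..t\<^sub>1}"
      then have s0: "s \<ge> T" "s \<ge> 0" using \<open>T \<le> t\<^sub>0\<close> t by auto
      have "memory x s \<ge> 0"
        unfolding set_lebesgue_integral_def
      proof (rule Bochner_Integration.integral_nonneg)
        fix \<xi>
        show "0 \<le> indicator {- T..0} \<xi> *\<^sub>R (a \<xi> * x (s + \<xi>))"
          using a_nonneg[of \<xi>] pos[of "s + \<xi>"] s0 by (cases "\<xi> \<in> {- T..0}") auto
      qed
      then have "g s \<ge> - C * x s"
        using drift_ge[of "x s" "memory x s"] pos[OF s0(2)] by (simp add: g_def state_rhs_def)
      \<comment> \<open>Below the barrier the loss \<open>C * x s\<close> is at most that of the
        barrier, which therefore falls at least as fast as \<open>x\<close>.\<close>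
      moreover have "x s \<le> k * exp (- C * s)"
        using d[of s] d0 s by (cases "s = t\<^sub>0") auto
      then have "C * x s \<le> C * (k * exp (- C * s))" using C_nonneg by (rule mult_left_mono)
      ultimately show "- C * (k * exp (- C * s)) \<le> g s" by simp
    qed
    also have "\<dots> = x t\<^sub>1 - x t\<^sub>0"
      using set_integral_increment[OF g(1), of t\<^sub>0] t sol by (simp add: solves_state_eq_def g_def)
    finally show "k * exp (- C * t\<^sub>1) - x t\<^sub>1 \<le> 0 * (E * exp (0 * t\<^sub>1))" using d0 by simp
  qed (use that in auto)
  show ?thesis using k le by (intro exI[of _ k]) (simp add: x_def)
qed

text \<open>The memory is linear in the trajectory and the drift concave, so the convex combination
  is a subsolution of the equation for \<open>\<mu> * c\<close>, with the same initial datum;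
  \<open>comparison\<close> concludes.\<close>

lemma state_convex_combination_le:
  assumes c: "c \<in> admissible T a f\<^sub>0 \<eta>" and \<mu>: "0 \<le> \<mu>" "\<mu> \<le> 1" and "t \<ge> 0"
  shows "(1 - \<mu>) * X (\<lambda>_. 0) t + \<mu> * X c t \<le> X (\<lambda>t. \<mu> * c t) t"
proof -
  define u v w where "u = X (\<lambda>_. 0)" and "v = X c" and "w = X (\<lambda>t. \<mu> * c t)"
  have u: "solves_state_eq T a f\<^sub>0 \<eta> (\<lambda>_. 0) u"
    using solves_admissible[OF c, of 0] by (simp add: u_def)
  have v: "solves_state_eq T a f\<^sub>0 \<eta> c v"
    using solves_admissible[OF c, of 1] by (simp add: v_def)
  have w: "solves_state_eq T a f\<^sub>0 \<eta> (\<lambda>t. \<mu> * c t) w"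
    using solves_admissible[OF c, of \<mu>] by (simp add: w_def)
  note sol = u v w
  note paths = sol[THEN solution_path]
  note starts = sol[THEN solution_start]
  define z where "z t = (1 - \<mu>) * u t + \<mu> * v t" for t
  define p where "p s = (1 - \<mu>) * state_rhs T a f\<^sub>0 (\<lambda>_. 0) u s + \<mu> * state_rhs T a f\<^sub>0 c v s" for s
  have z0: "z 0 = fst \<eta>" unfolding z_def starts by (simp add: algebra_simps)
  have "z t \<le> w t"
  proof (rule comparison[where z = z and w = w and p = p and q = "state_rhs T a f\<^sub>0 (\<lambda>t. \<mu> * c t) w"])
    show "path z"
      using paths unfolding path_def z_def[abs_def]
      by (intro conjI continuous_intros set_integral_add set_integrable_mult_right) auto
    show "path w" by (rule paths)
    show "z r = w r" if "r \<in> {- T..<0}" for r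
      using sol that by (simp add: z_def solves_state_eq_def algebra_simps)
    show "z 0 \<le> w 0" unfolding z0 starts by simp
    show "set_integrable lebesgue {0..t} p" if "t \<ge> 0" for t
      unfolding p_def[abs_def] using u v that
      by (intro set_integral_add set_integrable_mult_right) (auto simp: solves_state_eq_def)
    show "set_integrable lebesgue {0..t} (state_rhs T a f\<^sub>0 (\<lambda>t. \<mu> * c t) w)" if "t \<ge> 0" for t
      using w that by (simp add: solves_state_eq_def)
    show "w t = w 0 + (LINT s:{0..t}|lebesgue. state_rhs T a f\<^sub>0 (\<lambda>t. \<mu> * c t) w s)" if "t \<ge> 0" for t
      unfolding starts using w that by (simp add: solves_state_eq_def)
    show "z t = z 0 + (LINT s:{0..t}|lebesgue. p s)" if "t \<ge> 0" for t
    proof -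
      have i: "set_integrable lebesgue {0..t} (state_rhs T a f\<^sub>0 (\<lambda>_. 0) u)"
        "set_integrable lebesgue {0..t} (state_rhs T a f\<^sub>0 c v)"
        using u v that by (auto simp: solves_state_eq_def)
      have "u t = fst \<eta> + (LINT s:{0..t}|lebesgue. state_rhs T a f\<^sub>0 (\<lambda>_. 0) u s)"
        "v t = fst \<eta> + (LINT s:{0..t}|lebesgue. state_rhs T a f\<^sub>0 c v s)"
        using u v that by (auto simp: solves_state_eq_def)
      then have "z t = fst \<eta> + ((1 - \<mu>) * (LINT s:{0..t}|lebesgue. state_rhs T a f\<^sub>0 (\<lambda>_. 0) u s)
          + \<mu> * (LINT s:{0..t}|lebesgue. state_rhs T a f\<^sub>0 c v s))"
        unfolding z_def by (simp add: algebra_simps)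
      also have "(1 - \<mu>) * (LINT s:{0..t}|lebesgue. state_rhs T a f\<^sub>0 (\<lambda>_. 0) u s)
          + \<mu> * (LINT s:{0..t}|lebesgue. state_rhs T a f\<^sub>0 c v s) = (LINT s:{0..t}|lebesgue. p s)"
        unfolding p_def using i by (subst set_integral_add(2)) auto
      finally show ?thesis unfolding z0 .
    qed
    fix s :: real assume s: "s \<ge> 0"
    have "memory z s = (LINT \<xi>:{- T..0}|lebesgue. (1 - \<mu>) * (a \<xi> * u (s + \<xi>)) + \<mu> * (a \<xi> * v (s + \<xi>)))"
      by (simp add: z_def algebra_simps)
    also have "\<dots> = (1 - \<mu>) * memory u s + \<mu> * memory v s"
      using memory_integrable[OF paths(1) s] memory_integrable[OF paths(2) s]
      by (subst set_integral_add(2)) auto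
    finally have m: "memory z s = (1 - \<mu>) * memory u s + \<mu> * memory v s" .
    \<comment> \<open>Concavity of \<open>f\<^sub>0\<close> is assumed for nonnegative states;
      positivity of both states places them in that region, where \<open>F\<close> agrees with
      \<open>f\<^sub>0\<close>.\<close>
    have us: "u s > 0" using state_null_pos[OF c s] by (simp add: u_def)
    have vs: "v s > 0" using c s by (simp add: v_def admissible_def)
    have zs: "z s \<ge> 0" using us vs \<mu> by (simp add: z_def)
    have "concave_on ({0..} \<times> UNIV) (\<lambda>(x, y). f\<^sub>0 x y)"
      using drift by (simp add: drift_def)
    then have "(1 - \<mu>) * f\<^sub>0 (u s) (memory u s) + \<mu> * f\<^sub>0 (v s) (memory v s) \<le> f\<^sub>0 (z s) (memory z s)"
      using concave_onD[of "{0..} \<times> UNIV" "\<lambda>(x, y). f\<^sub>0 x y" \<mu> "(u s, memory u s)" "(v s, memory v s)"] \<mu> us vs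
      unfolding m unfolding z_def by simp
    then show "p s - state_rhs T a f\<^sub>0 (\<lambda>t. \<mu> * c t) w s \<le> F (z s) (memory z s) - F (w s) (memory w s)"
      using us vs zs by (simp add: p_def state_rhs_def drift_ext_def algebra_simps)
  qed fact
  then show ?thesis by (simp add: z_def u_def v_def w_def)
qed

text \<open>Dropping the positive term \<open>\<mu> * X c t\<close> from the convex combination
  leaves \<open>1 - \<mu>\<close> times the bound for the null control, which yields admissibility
  too.\<close>

lemma scaled_control:
  assumes c: "c \<in> admissible T a f\<^sub>0 \<eta>"
    and \<mu>: "0 < \<mu>" "\<mu> < 1"
  shows "(\<lambda>t. \<mu> * c t) \<in> admissible T a f\<^sub>0 \<eta>"
    and "\<exists>k>0. \<forall>t\<ge>0. X (\<lambda>t. \<mu> * c t) t \<ge> k * exp (- C * t)"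
proof -
  obtain k where k: "k > 0" "\<forall>t\<ge>0. X (\<lambda>_. 0) t \<ge> k * exp (- C * t)"
    using state_null_lower_bound[OF c] by blast
  have le: "(1 - \<mu>) * k * exp (- C * t) \<le> X (\<lambda>t. \<mu> * c t) t" if "t \<ge> 0" for t
  proof -
    have "(1 - \<mu>) * (k * exp (- C * t)) \<le> (1 - \<mu>) * X (\<lambda>_. 0) t"
      using k(2) that \<mu> by (intro mult_left_mono) auto
    also have "\<dots> \<le> (1 - \<mu>) * X (\<lambda>_. 0) t + \<mu> * X c t"
      using c that \<mu> by (auto simp: admissible_def less_imp_le)
    also have "\<dots> \<le> X (\<lambda>t. \<mu> * c t) t"
      using that \<mu> by (intro state_convex_combination_le c) auto
    finally show ?thesis by (simp add: mult.assoc)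
  qed
  have k': "(1 - \<mu>) * k > 0" using k(1) \<mu> by simp
  then show "\<exists>k>0. \<forall>t\<ge>0. X (\<lambda>t. \<mu> * c t) t \<ge> k * exp (- C * t)"
    using le by blast
  have "X (\<lambda>t. \<mu> * c t) t > 0" if "t \<ge> 0" for t
    by (rule less_le_trans[OF _ le[OF that]]) (use k' in simp)
  then show "(\<lambda>t. \<mu> * c t) \<in> admissible T a f\<^sub>0 \<eta>"
    using c \<mu> by (auto simp: admissible_def)
qed

lemma state_continuous:
  assumes "c \<in> admissible T a f\<^sub>0 \<eta>"
  shows "continuous_on {0..} (X c)"
  using solution_path[OF solves_admissible[OF assms, of 1]] by (simp add: path_def)

end

end

section \<open>Convergence of payoffs\<close>

text \<open>Positive parts grow and negative parts shrink. No integrability is asked, so payoffs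
  equal to \<open>-\<infinity>\<close> are covered.\<close>

lemma ext_integral_mono:
  assumes "\<And>t. t \<in> A \<Longrightarrow> g t \<le> h t"
  shows "ext_integral A g \<le> ext_integral A h"
proof -
  have "(\<integral>\<^sup>+ t\<in>A. ennreal (g t) \<partial>lebesgue) \<le> (\<integral>\<^sup>+ t\<in>A. ennreal (h t) \<partial>lebesgue)"
    "(\<integral>\<^sup>+ t\<in>A. ennreal (- h t) \<partial>lebesgue) \<le> (\<integral>\<^sup>+ t\<in>A. ennreal (- g t) \<partial>lebesgue)"
    using assms by (auto intro!: nn_integral_mono ennreal_leI split: split_indicator)
  then show ?thesis
    unfolding ext_integral_def by (intro ereal_minus_mono) (simp_all flip: less_eq_ennreal.rep_eq)
qed

lemma ext_integral_eq_lebesgue: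
  assumes "set_integrable lebesgue A g"
  shows "ext_integral A g = ereal (LINT t:A|lebesgue. g t)"
proof -
  define h where "h t = indicator A t *\<^sub>R g t" for t
  have h: "integrable lebesgue h"
    using assms by (simp add: set_integrable_def h_def[abs_def])
  have eq: "(\<integral>\<^sup>+ t\<in>A. ennreal (g t) \<partial>lebesgue) = (\<integral>\<^sup>+ t. ennreal (h t) \<partial>lebesgue)"
    "(\<integral>\<^sup>+ t\<in>A. ennreal (- g t) \<partial>lebesgue) = (\<integral>\<^sup>+ t. ennreal (- h t) \<partial>lebesgue)"
    by (auto intro!: nn_integral_cong simp: h_def split: split_indicator)
  have fin: "(\<integral>\<^sup>+ t. ennreal (h t) \<partial>lebesgue) \<noteq> \<infinity>" "(\<integral>\<^sup>+ t. ennreal (- h t) \<partial>lebesgue) \<noteq> \<infinity>"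
    using h by (auto simp: real_integrable_def)
  have real: "enn2ereal y = ereal (enn2real y)" if "y \<noteq> \<infinity>" for y
    using that by (cases y) auto
  show ?thesis
    unfolding ext_integral_def eq real[OF fin(1)] real[OF fin(2)]
    using real_lebesgue_integral_def[OF h]
    by (simp add: set_lebesgue_integral_def h_def[abs_def, symmetric] del: real_scaleR_def)
qed

text \<open>The positive part vanishes, so a value above \<open>-\<infinity>\<close> says that the
  negative part has finite integral.\<close>

lemma ext_integral_nonpos_integrable:
  assumes "set_borel_measurable lebesgue A g" "\<And>t. t \<in> A \<Longrightarrow> g t \<le> 0" "ext_integral A g > -\<infinity>"
  shows "set_integrable lebesgue A g"
proof -
  have "(\<integral>\<^sup>+ t\<in>A. ennreal (g t) \<partial>lebesgue) = (\<integral>\<^sup>+ (t::real). 0 \<partial>lebesgue)"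
    by (rule nn_integral_cong) (auto simp: ennreal_neg assms(2) split: split_indicator)
  then have "(\<integral>\<^sup>+ t\<in>A. ennreal (- g t) \<partial>lebesgue) \<noteq> \<infinity>"
    using assms(3) by (auto simp: ext_integral_def zero_ennreal.rep_eq)
  also have "(\<integral>\<^sup>+ t\<in>A. ennreal (- g t) \<partial>lebesgue) = (\<integral>\<^sup>+ t. ennreal (norm (indicator A t *\<^sub>R g t)) \<partial>lebesgue)"
    by (rule nn_integral_cong) (auto simp: assms(2) split: split_indicator)
  finally show ?thesis
    using assms(1) by (auto simp: set_integrable_def integrable_iff_bounded set_borel_measurable_def less_top)
qed

text \<open>Domination makes all the integrals finite, which reduces the claim to the usual theorem
  for Lebesgue integrals.\<close>

lemma ext_integral_dominated_convergence:
  fixes s :: "nat \<Rightarrow> real \<Rightarrow> real"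
  assumes s: "\<And>n. set_borel_measurable lebesgue A (s n)" and w: "set_integrable lebesgue A w"
    and lim: "\<And>t. t \<in> A \<Longrightarrow> (\<lambda>n. s n t) \<longlonglongrightarrow> f t"
    and bound: "\<And>n t. t \<in> A \<Longrightarrow> \<bar>s n t\<bar> \<le> w t"
  shows "(\<lambda>n. ext_integral A (s n)) \<longlonglongrightarrow> ext_integral A f"
proof -
  have L: "(\<lambda>n. indicator A t *\<^sub>R s n t) \<longlonglongrightarrow> indicator A t *\<^sub>R f t" for t
    using lim[of t] by (auto split: split_indicator)
  have sm: "(\<lambda>t. indicator A t *\<^sub>R s n t) \<in> borel_measurable lebesgue" for n
    using s by (simp add: set_borel_measurable_def)
  have fm: "(\<lambda>t. indicator A t *\<^sub>R f t) \<in> borel_measurable lebesgue"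
    by (rule borel_measurable_LIMSEQ_real[OF L sm])
  have wi: "integrable lebesgue (\<lambda>t. indicator A t *\<^sub>R w t)"
    using w by (simp add: set_integrable_def)
  have B: "norm (indicator A t *\<^sub>R s n t) \<le> indicator A t *\<^sub>R w t" for n t
    using bound[of t n] by (auto split: split_indicator)
  note dct = fm sm wi AE_I2[OF L] AE_I2[OF B]
  have "set_integrable lebesgue A f"
    unfolding set_integrable_def by (rule integrable_dominated_convergence[OF dct])
  moreover have "set_integrable lebesgue A (s n)" for n
    unfolding set_integrable_def by (rule integrable_dominated_convergence2[OF dct])
  moreover have "(\<lambda>n. LINT t:A|lebesgue. s n t) \<longlonglongrightarrow> (LINT t:A|lebesgue. f t)"
    unfolding set_lebesgue_integral_def by (rule integral_dominated_convergence[OF dct])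
  ultimately show ?thesis by (simp add: ext_integral_eq_lebesgue)
qed

section \<open>Integrability and measurability of discounted utilities\<close>

lemma set_integrable_exp:
  fixes \<rho> :: real
  assumes "\<rho> > 0"
  shows "set_integrable lebesgue {0..} (\<lambda>t. exp (- \<rho> * t))"
  using integrable_on_exp_minus_to_infinity[OF assms, of 0]
  by (intro nonnegative_absolutely_integrable_1) auto

lemma continuous_on_set_borel_measurable:
  fixes g :: "real \<Rightarrow> real"
  assumes "continuous_on {a..} g"
  shows "set_borel_measurable lebesgue {a..} g"
proof -
  have "(\<lambda>t. indicator {a..} t *\<^sub>R g t) \<in> borel_measurable lborel"
    using borel_measurable_continuous_on_indicator[OF _ assms] by simp
  then show ?thesis unfolding set_borel_measurable_def by (rule measurable_completion)
qed

lemma set_borel_measurable_times: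
  fixes g h :: "real \<Rightarrow> real"
  assumes "set_borel_measurable lebesgue A g" "set_borel_measurable lebesgue A h"
  shows "set_borel_measurable lebesgue A (\<lambda>t. g t * h t)"
proof -
  have "(\<lambda>t. (indicator A t *\<^sub>R g t) * (indicator A t *\<^sub>R h t)) \<in> borel_measurable lebesgue"
    using assms unfolding set_borel_measurable_def by (rule borel_measurable_times)
  also have "(\<lambda>t. (indicator A t *\<^sub>R g t) * (indicator A t *\<^sub>R h t)) = (\<lambda>t. indicator A t *\<^sub>R (g t * h t))"
    by (auto simp: fun_eq_iff split: split_indicator)
  finally show ?thesis by (simp add: set_borel_measurable_def)
qed

text \<open>A factor \<open>k\<close> in front of \<open>exp (- C * t)\<close> amounts to a time
  shift by \<open>s = - ln k / C\<close>; the integrand is thus \<open>exp (\<rho> * s)\<close>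
  times a translate of the one in \<open>state_utility\<close>.\<close>

lemma state_utility_exp_integrable:
  assumes U: "state_utility \<rho> C U" and nonpos: "\<And>x. x > 0 \<Longrightarrow> U x \<le> 0"
    and \<rho>: "\<rho> > 0" and C: "C \<ge> 0" and k: "0 < k" "k \<le> 1"
  shows "set_integrable lebesgue {0..} (\<lambda>t. exp (- \<rho> * t) * U (k * exp (- C * t)))"
proof (cases "C = 0")
  \<comment> \<open>Without decay no time shift produces \<open>k\<close>, but then the integrand is
    a multiple of the discount factor.\<close>
  case True
  then show ?thesis using set_integrable_exp[OF \<rho>] by simp
next
  case False
  define G where "G t = exp (- \<rho> * t) * U (exp (- C * t))" for t
  have "continuous_on {0..} G"
    unfolding G_def
  proof (intro continuous_on_mult)
    show "continuous_on {0..} (\<lambda>t. U (exp (- C * t)))"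
      by (rule continuous_on_compose2[of "{0<..}" U])
        (use U in \<open>auto simp: state_utility_def intro!: continuous_intros\<close>)
  qed (intro continuous_intros)
  then have "set_integrable lebesgue {0..} G"
  proof (intro ext_integral_nonpos_integrable continuous_on_set_borel_measurable)
    show "G t \<le> 0" for t using nonpos[of "exp (- C * t)"] by (simp add: G_def mult_nonneg_nonpos)
    show "ext_integral {0..} G > -\<infinity>" using U by (simp add: state_utility_def G_def[abs_def])
  qed
  define s where "s = - ln k / C"
  \<comment> \<open>Here \<open>k \<le> 1\<close> matters: the shifted half-line
    \<open>{s..}\<close> stays inside \<open>{0..}\<close>.\<close>
  have s: "s \<ge> 0" using k C by (simp add: s_def divide_nonpos_nonneg)
  have "exp (- C * s) = k" using False k by (simp add: s_def)
  moreover have "exp (- C * s) * exp (- C * t) = exp (- C * (s + t))" for t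
    by (simp add: mult_exp_exp distrib_left)
  ultimately have e1: "k * exp (- C * t) = exp (- C * (s + t))" for t by simp
  have e2: "exp (- \<rho> * t) = exp (\<rho> * s) * exp (- \<rho> * (s + t))" for t
    by (simp add: mult_exp_exp distrib_left)
  have eq: "exp (- \<rho> * t) * U (k * exp (- C * t)) = exp (\<rho> * s) * G (s + t)" for t
    by (subst e2) (simp only: G_def e1 mult.assoc)
  have "set_integrable lebesgue {s..} G"
    by (rule set_integrable_subset[OF \<open>set_integrable lebesgue {0..} G\<close>]) (use s in auto)
  then have "integrable lebesgue (\<lambda>t. indicator {s..} t *\<^sub>R G t)"
    by (simp add: set_integrable_def)
  from lebesgue_integrable_real_affine[OF this, of 1 s]
  have "set_integrable lebesgue {0..} (\<lambda>t. G (s + t))"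
    by (simp add: set_integrable_def indicator_def cong: if_cong)
  then show ?thesis unfolding eq by (rule set_integrable_mult_right)
qed

text \<open>The function is the pointwise limit of its truncations to
  \<open>{0..real n}\<close>.\<close>

lemma locally_integrable_imp_set_borel_measurable:
  fixes c :: "real \<Rightarrow> real"
  assumes "\<And>t. t \<ge> 0 \<Longrightarrow> set_integrable lebesgue {0..t} c"
  shows "set_borel_measurable lebesgue {0..} c"
  unfolding set_borel_measurable_def
proof (rule borel_measurable_LIMSEQ_real)
  show "(\<lambda>t. indicator {0..real n} t *\<^sub>R c t) \<in> borel_measurable lebesgue" for n
    using assms[of "real n"] by (auto simp: set_integrable_def)
  fix t :: real
  obtain N where N: "t \<le> real N" using real_arch_simple by blast
  have "\<forall>\<^sub>F n in sequentially. indicator {0..real n} t *\<^sub>R c t = indicator {0..} t *\<^sub>R c t"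
    using eventually_ge_at_top[of N]
    by eventually_elim (use N in \<open>auto split: split_indicator\<close>)
  then show "(\<lambda>n. indicator {0..real n} t *\<^sub>R c t) \<longlonglongrightarrow> indicator {0..} t *\<^sub>R c t"
    by (rule tendsto_eventually)
qed

text \<open>Replacing \<open>U y\<close> by \<open>U (max y 0)\<close> gives a function continuous
  on the whole line without changing the values at \<open>c t \<ge> 0\<close>.\<close>

lemma set_borel_measurable_continuous_compose:
  fixes c U :: "real \<Rightarrow> real"
  assumes c: "set_borel_measurable lebesgue {0..} c" and U: "continuous_on {0..} U"
    and nonneg: "\<And>t. t \<ge> 0 \<Longrightarrow> c t \<ge> 0"
  shows "set_borel_measurable lebesgue {0..} (\<lambda>t. U (c t))"
proof -
  have "continuous_on UNIV (\<lambda>y. U (max y 0))"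
    by (rule continuous_on_compose2[OF U]) (intro continuous_intros, auto)
  then have m: "(\<lambda>y. U (max y 0)) \<in> borel_measurable borel"
    by (rule borel_measurable_continuous_onI)
  have "(\<lambda>t. indicator {0..} t *\<^sub>R c t) \<in> lebesgue \<rightarrow>\<^sub>M borel"
    using c by (simp add: set_borel_measurable_def)
  note m' = measurable_compose[OF this m]
  have "(\<lambda>t. indicator {0..} t *\<^sub>R U (max (indicator {0..} t *\<^sub>R c t) 0)) \<in> borel_measurable lebesgue"
    by (rule borel_measurable_scaleR[OF borel_measurable_indicator m']) simp
  moreover have "indicator {0..} t *\<^sub>R U (max (indicator {0..} t *\<^sub>R c t) 0) = indicator {0..} t *\<^sub>R U (c t)" for t
    using nonneg[of t] by (cases "t \<ge> 0") (simp_all add: max_absorb1)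
  ultimately show ?thesis unfolding set_borel_measurable_def by (simp only:)
qed

lemma consumption_utility_bound:
  assumes "consumption_utility U\<^sub>1"
  shows "\<exists>M\<ge>0. \<forall>y\<ge>0. \<bar>U\<^sub>1 y\<bar> \<le> M"
proof -
  have "bounded (U\<^sub>1 ` {0..})" using assms by (simp add: consumption_utility_def)
  then obtain M where "\<forall>y\<in>{0..}. \<bar>U\<^sub>1 y\<bar> \<le> M"
    by (auto simp: bounded_iff)
  moreover from this have "\<bar>U\<^sub>1 0\<bar> \<le> M" by simp
  then have "M \<ge> 0" by linarith
  ultimately show ?thesis by (intro exI[of _ M]) simp
qed

section \<open>Limits and bounds for payoffs\<close>

text \<open>Since \<open>U\<^sub>1\<close> is bounded and continuous up to 0, the discount factor
  times a bound of \<open>U\<^sub>1\<close> dominates.\<close>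

lemma payoff0_scaled_tendsto:
  assumes U\<^sub>1: "consumption_utility U\<^sub>1" and \<rho>: "\<rho> > 0"
    and c: "\<And>t. t \<ge> 0 \<Longrightarrow> c t \<ge> 0" "\<And>t. t \<ge> 0 \<Longrightarrow> set_integrable lebesgue {0..t} c"
    and \<mu>: "\<And>n. \<mu> n \<ge> 0" "\<mu> \<longlonglongrightarrow> 1"
  shows "(\<lambda>n. payoff0 \<rho> U\<^sub>1 (\<lambda>t. \<mu> n * c t)) \<longlonglongrightarrow> payoff0 \<rho> U\<^sub>1 c"
proof -
  have cont: "continuous_on {0..} U\<^sub>1" using U\<^sub>1 by (simp add: consumption_utility_def)
  obtain M where M: "M \<ge> 0" "\<forall>y\<ge>0. \<bar>U\<^sub>1 y\<bar> \<le> M"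
    using consumption_utility_bound[OF U\<^sub>1] by blast
  show ?thesis
    unfolding payoff0_def
  proof (rule ext_integral_dominated_convergence[where w = "\<lambda>t. exp (- \<rho> * t) * M"])
    show "set_integrable lebesgue {0..} (\<lambda>t. exp (- \<rho> * t) * M)"
      using set_integrable_exp[OF \<rho>] by (rule set_integrable_mult_left)
    fix t :: real assume t: "t \<in> {0..}"
    show "\<bar>exp (- \<rho> * t) * U\<^sub>1 (\<mu> n * c t)\<bar> \<le> exp (- \<rho> * t) * M" for n
      using M c t \<mu> by (simp add: abs_mult)
    have "(\<lambda>n. \<mu> n * c t) \<longlonglongrightarrow> 1 * c t"
      by (intro tendsto_mult_right \<mu>)
    then have "(\<lambda>n. U\<^sub>1 (\<mu> n * c t)) \<longlonglongrightarrow> U\<^sub>1 (1 * c t)"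
      by (intro continuous_on_tendsto_compose[OF cont]) (use c t \<mu> in auto)
    then show "(\<lambda>n. exp (- \<rho> * t) * U\<^sub>1 (\<mu> n * c t)) \<longlonglongrightarrow> exp (- \<rho> * t) * U\<^sub>1 (c t)"
      by (intro tendsto_mult_left) simp
  next
    fix n
    have "set_borel_measurable lebesgue {0..} (\<lambda>t. U\<^sub>1 (\<mu> n * c t))"
      by (rule set_borel_measurable_continuous_compose[OF locally_integrable_imp_set_borel_measurable cont])
        (use c \<mu> in auto)
    then show "set_borel_measurable lebesgue {0..} (\<lambda>t. exp (- \<rho> * t) * U\<^sub>1 (\<mu> n * c t))"
      by (rule set_borel_measurable_times[OF continuous_on_set_borel_measurable, rotated])
        (intro continuous_intros)
  qed
qed

text \<open>Monotonicity in \<open>n\<close> and in the state places \<open>U\<^sub>2 n\<close>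
  along the trajectory between 0 and \<open>U\<^sub>2 1\<close> along a multiple of
  \<open>exp (- C * t)\<close>, which is integrable after discounting.\<close>

lemma payoff_tendsto_payoff0:
  assumes U\<^sub>1: "consumption_utility U\<^sub>1" and \<rho>: "\<rho> > 0" and C: "C \<ge> 0"
    and U\<^sub>2: "\<And>n. n \<ge> 1 \<Longrightarrow> state_utility \<rho> C (U\<^sub>2 n)"
    and U\<^sub>2_nonpos: "\<And>n x. n \<ge> 1 \<Longrightarrow> x > 0 \<Longrightarrow> U\<^sub>2 n x \<le> 0"
    and U\<^sub>2_ge: "\<And>n x. n \<ge> 1 \<Longrightarrow> x > 0 \<Longrightarrow> U\<^sub>2 1 x \<le> U\<^sub>2 n x"
    and U\<^sub>2_lim: "\<And>x. x > 0 \<Longrightarrow> (\<lambda>n. U\<^sub>2 n x) \<longlonglongrightarrow> 0"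
    and c: "c \<in> admissible T a f\<^sub>0 \<eta>" and cont: "continuous_on {0..} (state T a f\<^sub>0 \<eta> c)"
    and k: "k > 0" "\<And>t. t \<ge> 0 \<Longrightarrow> k * exp (- C * t) \<le> state T a f\<^sub>0 \<eta> c t"
  shows "(\<lambda>n. payoff T \<rho> a f\<^sub>0 U\<^sub>1 (U\<^sub>2 n) \<eta> c) \<longlonglongrightarrow> payoff0 \<rho> U\<^sub>1 c"
\<comment> \<open>The hypotheses on \<open>U\<^sub>2 n\<close> start at \<open>n = 1\<close>, so the
  sequence is shifted by one.\<close>
proof (rule LIMSEQ_imp_Suc)
  obtain M where M: "M \<ge> 0" "\<forall>y\<ge>0. \<bar>U\<^sub>1 y\<bar> \<le> M"
    using consumption_utility_bound[OF U\<^sub>1] by blast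
  define x where "x = state T a f\<^sub>0 \<eta> c"
  have pos: "x t > 0" if "t \<ge> 0" for t
    using c that by (simp add: admissible_def x_def)
  have c_nonneg: "c t \<ge> 0" if "t \<ge> 0" for t
    using c that by (simp add: admissible_def)
  \<comment> \<open>\<open>state_utility_exp_integrable\<close> needs a factor at most 1; lowering
    \<open>k\<close> keeps the bound on the state.\<close>
  define k' where "k' = min k 1"
  have k': "0 < k'" "k' \<le> 1" using k by (auto simp: k'_def)
  define b where "b t = exp (- \<rho> * t) * U\<^sub>2 1 (k' * exp (- C * t))" for t
  have x_ge: "k' * exp (- C * t) \<le> x t" if "t \<ge> 0" for t
  proof -
    have "k' * exp (- C * t) \<le> k * exp (- C * t)" by (rule mult_right_mono) (simp_all add: k'_def)
    from this k(2)[OF that] show ?thesis unfolding x_def by (rule order_trans)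
  qed
  show "(\<lambda>n. payoff T \<rho> a f\<^sub>0 U\<^sub>1 (U\<^sub>2 (Suc n)) \<eta> c) \<longlonglongrightarrow> payoff0 \<rho> U\<^sub>1 c"
    unfolding payoff_def payoff0_def x_def[symmetric]
  proof (rule ext_integral_dominated_convergence[where w = "\<lambda>t. exp (- \<rho> * t) * M + \<bar>b t\<bar>"])
    show "set_integrable lebesgue {0..} (\<lambda>t. exp (- \<rho> * t) * M + \<bar>b t\<bar>)"
    proof (intro set_integral_add set_integrable_abs)
      show "set_integrable lebesgue {0..} (\<lambda>t. exp (- \<rho> * t) * M)"
        using set_integrable_exp[OF \<rho>] by (rule set_integrable_mult_left)
      show "set_integrable lebesgue {0..} b"
        unfolding b_def by (rule state_utility_exp_integrable) (use U\<^sub>2 U\<^sub>2_nonpos \<rho> C k' in auto)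
    qed
    fix t :: real assume "t \<in> {0..}"
    then have t: "t \<ge> 0" by simp
    have "(\<lambda>n. exp (- \<rho> * t) * (U\<^sub>1 (c t) + U\<^sub>2 (Suc n) (x t))) \<longlonglongrightarrow> exp (- \<rho> * t) * (U\<^sub>1 (c t) + 0)"
      by (intro tendsto_intros LIMSEQ_Suc U\<^sub>2_lim pos t)
    then show "(\<lambda>n. exp (- \<rho> * t) * (U\<^sub>1 (c t) + U\<^sub>2 (Suc n) (x t))) \<longlonglongrightarrow> exp (- \<rho> * t) * U\<^sub>1 (c t)"
      by simp
    fix n
    have "mono_on {0<..} (U\<^sub>2 1)" using U\<^sub>2[of 1] by (simp add: state_utility_def)
    then have "U\<^sub>2 1 (k' * exp (- C * t)) \<le> U\<^sub>2 1 (x t)"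
      by (rule mono_onD) (use k' pos[OF t] x_ge[OF t] in auto)
    also have "\<dots> \<le> U\<^sub>2 (Suc n) (x t)" by (rule U\<^sub>2_ge) (use pos[OF t] in auto)
    finally have "\<bar>U\<^sub>2 (Suc n) (x t)\<bar> \<le> \<bar>U\<^sub>2 1 (k' * exp (- C * t))\<bar>"
      using U\<^sub>2_nonpos[of "Suc n" "x t"] pos[OF t] by simp
    then have "\<bar>U\<^sub>1 (c t) + U\<^sub>2 (Suc n) (x t)\<bar> \<le> M + \<bar>U\<^sub>2 1 (k' * exp (- C * t))\<bar>"
      using M(2) c_nonneg[OF t] by (intro order_trans[OF abs_triangle_ineq] add_mono) auto
    then show "\<bar>exp (- \<rho> * t) * (U\<^sub>1 (c t) + U\<^sub>2 (Suc n) (x t))\<bar> \<le> exp (- \<rho> * t) * M + \<bar>b t\<bar>"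
      by (simp add: abs_mult b_def flip: distrib_left)
  next
    fix n
    have "set_borel_measurable lebesgue {0..} c"
      by (rule locally_integrable_imp_set_borel_measurable) (use c in \<open>simp add: admissible_def\<close>)
    moreover have "continuous_on {0..} U\<^sub>1" using U\<^sub>1 by (simp add: consumption_utility_def)
    ultimately have U\<^sub>1_meas: "set_borel_measurable lebesgue {0..} (\<lambda>t. U\<^sub>1 (c t))"
      using c_nonneg by (rule set_borel_measurable_continuous_compose)
    have "continuous_on {0..} (\<lambda>t. U\<^sub>2 (Suc n) (x t))"
      by (rule continuous_on_compose2[of "{0<..}" "U\<^sub>2 (Suc n)"])
        (use U\<^sub>2[of "Suc n"] cont pos in \<open>auto simp: state_utility_def x_def\<close>)
    then have "set_borel_measurable lebesgue {0..} (\<lambda>t. U\<^sub>2 (Suc n) (x t))"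
      by (rule continuous_on_set_borel_measurable)
    with U\<^sub>1_meas have "set_borel_measurable lebesgue {0..} (\<lambda>t. U\<^sub>1 (c t) + U\<^sub>2 (Suc n) (x t))"
      unfolding set_borel_measurable_def scaleR_add_right by (rule borel_measurable_add)
    then show "set_borel_measurable lebesgue {0..} (\<lambda>t. exp (- \<rho> * t) * (U\<^sub>1 (c t) + U\<^sub>2 (Suc n) (x t)))"
      by (rule set_borel_measurable_times[OF continuous_on_set_borel_measurable, rotated])
        (intro continuous_intros)
  qed
qed

text \<open>A bound uniform in the control makes the value \<open>V\<^sub>0\<close> finite from
  above, so that subtracting \<open>\<epsilon>\<close> lowers it strictly.\<close>

lemma payoff0_bounded:
  assumes U\<^sub>1: "consumption_utility U\<^sub>1" and \<rho>: "\<rho> > 0"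
  shows "\<exists>B. \<forall>c. (\<forall>t\<ge>0. c t \<ge> 0) \<longrightarrow> payoff0 \<rho> U\<^sub>1 c \<le> ereal B"
proof -
  obtain M where M: "M \<ge> 0" "\<forall>y\<ge>0. \<bar>U\<^sub>1 y\<bar> \<le> M"
    using consumption_utility_bound[OF U\<^sub>1] by blast
  have i: "set_integrable lebesgue {0..} (\<lambda>t. exp (- \<rho> * t) * M)"
    using set_integrable_exp[OF \<rho>] by (rule set_integrable_mult_left)
  have "payoff0 \<rho> U\<^sub>1 c \<le> ext_integral {0..} (\<lambda>t. exp (- \<rho> * t) * M)" if "\<forall>t\<ge>0. c t \<ge> 0" for c
    unfolding payoff0_def using M that by (intro ext_integral_mono mult_left_mono) (auto simp: abs_le_iff)
  then show ?thesis unfolding ext_integral_eq_lebesgue[OF i] by blast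
qed

section \<open>Convergence of the value functions and near-optimality of the feedback
  strategies\<close>

theorem proposition4p3:
  fixes T \<rho> C \<epsilon> :: real
    and a U\<^sub>1 :: "real \<Rightarrow> real"
    and f\<^sub>0 :: "real \<Rightarrow> real \<Rightarrow> real"
    and U\<^sub>2 :: "nat \<Rightarrow> real \<Rightarrow> real"
    and \<eta> :: datum
  assumes "T > 0" and "\<rho> > 0"
    and "delay_kernel T a"
    and "drift f\<^sub>0 C"
    and "consumption_utility U\<^sub>1"
    and "\<And>n. n \<ge> 1 \<Longrightarrow> state_utility \<rho> C (U\<^sub>2 n)"
    and "\<And>n x. n \<ge> 1 \<Longrightarrow> x > 0 \<Longrightarrow> U\<^sub>2 n x \<le> U\<^sub>2 (Suc n) x"
    and "\<And>x. x > 0 \<Longrightarrow> (\<lambda>n. U\<^sub>2 n x) \<longlonglongrightarrow> 0"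
    and "\<And>n. n \<ge> 1 \<Longrightarrow> not_integrable_at_zero (U\<^sub>2 n)"
    and "\<And>n x. n \<ge> 1 \<Longrightarrow> x \<ge> 1 / real n \<Longrightarrow> U\<^sub>2 n x = 0"
    and "\<eta> \<in> dom_value_fun0 T \<rho> a f\<^sub>0 U\<^sub>1"
    and "\<epsilon> > 0"
  shows "(\<lambda>n. value_fun T \<rho> a f\<^sub>0 U\<^sub>1 (U\<^sub>2 n) \<eta>) \<longlonglongrightarrow> value_fun0 T \<rho> a f\<^sub>0 U\<^sub>1 \<eta> \<and>
    (\<forall>c :: nat \<Rightarrow> control.
       (\<forall>n\<ge>1. c n \<in> admissible T a f\<^sub>0 \<eta> \<and>
               feedback_strategy T \<rho> a f\<^sub>0 U\<^sub>1 (U\<^sub>2 n) \<eta> (c n) \<and>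
               payoff T \<rho> a f\<^sub>0 U\<^sub>1 (U\<^sub>2 n) \<eta> (c n) = value_fun T \<rho> a f\<^sub>0 U\<^sub>1 (U\<^sub>2 n) \<eta>) \<longrightarrow>
       (\<forall>\<^sub>F n in sequentially. payoff0 \<rho> U\<^sub>1 (c n) > value_fun0 T \<rho> a f\<^sub>0 U\<^sub>1 \<eta> - ereal \<epsilon>))"
proof -
  interpret delay_equation T C a f\<^sub>0
    using assms(1,3,4) by unfold_locales
  define V where "V n = value_fun T \<rho> a f\<^sub>0 U\<^sub>1 (U\<^sub>2 n) \<eta>" for n
  define V\<^sub>0 where "V\<^sub>0 = value_fun0 T \<rho> a f\<^sub>0 U\<^sub>1 \<eta>"
  define Adm where "Adm = admissible T a f\<^sub>0 \<eta>"
  define J where "J n c = payoff T \<rho> a f\<^sub>0 U\<^sub>1 (U\<^sub>2 n) \<eta> c" for n c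
  have V_def': "V n = (SUP c\<in>Adm. J n c)" for n
    by (simp add: V_def value_fun_def Adm_def J_def)
  have V\<^sub>0_def': "V\<^sub>0 = (SUP c\<in>Adm. payoff0 \<rho> U\<^sub>1 c)"
    by (simp add: V\<^sub>0_def value_fun0_def Adm_def)
  have \<eta>: "set_integrable lebesgue {- T..0} (snd \<eta>)"
    using assms(11) by (auto simp: dom_value_fun0_def H_plus_def intro: square_integrable_imp_integrable)
  have increasing: "U\<^sub>2 m x \<le> U\<^sub>2 n x" if "1 \<le> m" "m \<le> n" "x > 0" for m n x
    using that(2)
  proof (induction rule: dec_induct)
    case (step i)
    then show ?case using assms(7)[of i x] that(1,3) by simp
  qed simp
  \<comment> \<open>An increasing sequence stays below its limit.\<close>
  have nonpos: "U\<^sub>2 n x \<le> 0" if "n \<ge> 1" "x > 0" for n x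
    by (rule LIMSEQ_le_const[OF assms(8)[OF that(2)]]) (use increasing[OF that(1) _ that(2)] in blast)
  have J_le: "J n c \<le> payoff0 \<rho> U\<^sub>1 c" if "n \<ge> 1" "c \<in> Adm" for n c
    unfolding J_def payoff_def payoff0_def
    by (rule ext_integral_mono) (use nonpos[OF that(1)] that(2) in \<open>auto simp: Adm_def admissible_def\<close>)
  have V_le: "V n \<le> V\<^sub>0" if "n \<ge> 1" for n
    unfolding V_def' V\<^sub>0_def' by (rule SUP_mono) (use J_le[OF that] in blast)
  \<comment> \<open>Used twice: for arbitrary \<open>y\<close> it is the lower half of the
    convergence, for \<open>y = V\<^sub>0 - ereal \<epsilon>\<close> it gives
    near-optimality.\<close>
  have lower: "\<forall>\<^sub>F n in sequentially. y < V n" if y: "y < V\<^sub>0" for y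
  proof -
    obtain c where c: "c \<in> Adm" "y < payoff0 \<rho> U\<^sub>1 c"
      using y unfolding V\<^sub>0_def' less_SUP_iff by blast
    \<comment> \<open>The double successor keeps \<open>\<mu> n\<close> strictly between 0 and 1
      already for \<open>n = 0\<close>.\<close>
    define \<mu> where "\<mu> n = 1 - 1 / real (Suc (Suc n))" for n
    have \<mu>: "0 < \<mu> n" "\<mu> n < 1" for n by (simp_all add: \<mu>_def)
    have "(\<lambda>n. 1 / real (Suc (Suc n))) \<longlonglongrightarrow> 0"
      using LIMSEQ_Suc[OF LIMSEQ_inverse_real_of_nat] by (simp add: inverse_eq_divide)
    then have "\<mu> \<longlonglongrightarrow> 1 - 0"
      unfolding \<mu>_def by (intro tendsto_intros)
    then have "(\<lambda>n. payoff0 \<rho> U\<^sub>1 (\<lambda>t. \<mu> n * c t)) \<longlonglongrightarrow> payoff0 \<rho> U\<^sub>1 c"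
      using c(1) \<mu> by (intro payoff0_scaled_tendsto assms) (auto simp: Adm_def admissible_def less_imp_le)
    then obtain n where n: "y < payoff0 \<rho> U\<^sub>1 (\<lambda>t. \<mu> n * c t)"
      using order_tendstoD(1)[OF _ c(2)] eventually_happens'[OF sequentially_bot] by blast
    \<comment> \<open>The scaling is fixed before the index of the state utility tends to infinity,
      so \<open>k\<close> below does not depend on that index.\<close>
    define d where "d = (\<lambda>t. \<mu> n * c t)"
    have d: "d \<in> Adm"
      unfolding d_def Adm_def by (rule scaled_control(1)[OF \<eta>]) (use c \<mu> in \<open>auto simp: Adm_def\<close>)
    obtain k where k: "k > 0" "\<forall>t\<ge>0. state T a f\<^sub>0 \<eta> d t \<ge> k * exp (- C * t)"
      using scaled_control(2)[OF \<eta>, of c "\<mu> n"] c \<mu> by (auto simp: Adm_def d_def)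
    have "(\<lambda>n. J n d) \<longlonglongrightarrow> payoff0 \<rho> U\<^sub>1 d"
      unfolding J_def
    proof (rule payoff_tendsto_payoff0[where C = C and k = k])
      show "continuous_on {0..} (state T a f\<^sub>0 \<eta> d)"
        using d unfolding Adm_def by (rule state_continuous[OF \<eta>])
    qed (use assms(2,5,6,8) C_nonneg nonpos increasing d k in \<open>auto simp: Adm_def\<close>)
    then have "\<forall>\<^sub>F n in sequentially. y < J n d"
      by (rule order_tendstoD) (use n in \<open>simp add: d_def\<close>)
    then show ?thesis
      by eventually_elim (use d in \<open>auto simp: V_def' intro: less_le_trans SUP_upper\<close>)
  qed
  have lim: "V \<longlonglongrightarrow> V\<^sub>0"
  proof (rule order_tendstoI)
    show "\<forall>\<^sub>F n in sequentially. V n < y" if "V\<^sub>0 < y" for y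
      using eventually_ge_at_top[of 1] by eventually_elim (use V_le that in \<open>auto intro: le_less_trans\<close>)
  qed (rule lower)
  obtain B where B: "\<forall>c. (\<forall>t\<ge>0. c t \<ge> 0) \<longrightarrow> payoff0 \<rho> U\<^sub>1 c \<le> ereal B"
    using payoff0_bounded[OF assms(5,2)] by blast
  have "V\<^sub>0 \<le> ereal B"
    unfolding V\<^sub>0_def' by (rule SUP_least) (use B in \<open>auto simp: Adm_def admissible_def\<close>)
  moreover have "V\<^sub>0 > -\<infinity>"
    using assms(11) by (simp add: dom_value_fun0_def V\<^sub>0_def)
  \<comment> \<open>Strictness requires \<open>V\<^sub>0\<close> to be finite.\<close>
  ultimately have "V\<^sub>0 - ereal \<epsilon> < V\<^sub>0"
    using \<open>\<epsilon> > 0\<close> by (cases V\<^sub>0) auto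
  \<comment> \<open>For large \<open>n\<close> the chain is \<open>V\<^sub>0 - ereal \<epsilon> < V
    n = J n (c n) \<le> payoff0 \<rho> U\<^sub>1 (c n)\<close>.\<close>
  from lower[OF this] have "\<forall>\<^sub>F n in sequentially. V\<^sub>0 - ereal \<epsilon> < payoff0 \<rho> U\<^sub>1 (c n)"
    if "\<forall>n\<ge>1. c n \<in> Adm \<and> J n (c n) = V n" for c :: "nat \<Rightarrow> control"
    using eventually_ge_at_top[of 1]
  proof eventually_elim
    case (elim n)
    then show ?case using that J_le[of n "c n"] by (auto intro: less_le_trans)
  qed
  with lim show ?thesis
    unfolding V_def[abs_def] V\<^sub>0_def Adm_def J_def by blast
qed

end
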